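(* Let $S_1\in\mathbb{R}^{p_1\times n}$ and $S_2\in\mathbb{R}^{p_2\times p_1}$ be independently generated $(\varepsilon_1,d_1,m)$ and $(\varepsilon_2,d_2,m)$ oblivious $\ell_2$-subspace embeddings, respectively. Put $d=d_1+d_2-d_1d_2$, $\varepsilon_L=\varepsilon_1+\varepsilon_2-\varepsilon_1\varepsilon_2$, $\varepsilon_H=\varepsilon_1+\varepsilon_2+\varepsilon_1\varepsilon_2$, and suppose $\varepsilon_L\in\left[0,\frac{616}{625}-\frac{9}{625}\varepsilon_H\right)$. Suppose $V\in\mathbb{R}^{n\times m}$ has full rank, $1<m\le p_2\le p_1\le n$, $nm\mathbf{u}\le\frac1{12}$, $p_1\sqrt{p_2}\,\mathbf{u}\le\frac1{12}$, and $$\delta:=\frac{383\left(\sqrt{1+\varepsilon_H}\,p_2m^{3/2}+\sqrt m\,\|S_2\|_2\left(p_1\sqrt{p_2}\sqrt{1+\varepsilon_1}+n\|S_1\|_F\right)\right)}{\sqrt{1-\varepsilon_L}}\,\mathbf{u}\,\kappa(V)\le 1 .$$ Let $\hat Q,\hat R$ be the factors computed in floating point arithmetic by $\texttt{rand\_cholQR}(V,S_1,S_2)$. Then, with probability at least $1-d$, $$\|\hat Q^T\hat Q-I\|_2\le\frac{5445}{\left(25\sqrt{\frac{1-\varepsilon_L}{1+\varepsilon_H}}-3\right)^2}\,(nm+m(m+1))\,\mathbf{u}$$ and $$\|V-\hat Q\hat R\|_2\le\left(\frac{56}{25\frac{1-\varepsilon_L}{\sqrt{1+\varepsilon_H}}-3\sqrt{1-\varepsilon_L}}+\frac{1.5}{\sqrt{1-\varepsilon_L}}\sqrt{1+\frac{5445(nm+m(m+1))\mathbf{u}}{\left(25\sqrt{\frac{1-\varepsilon_L}{1+\varepsilon_H}}-3\right)^2}}\right)\left(\sqrt{1+\varepsilon_H}\,\|V\|_2+\frac{\sqrt{1-\varepsilon_L}}{12}\sigma_m(V)\,\delta\right)m^2\mathbf{u}+\frac{\delta}{10}\sigma_m(V).$$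 (That is, the orthogonality error is $O(\mathbf{u})$ and the factorization error is $O(\mathbf{u})\|V\|_2$.)
   Context: Embeddings. For $\varepsilon\in[0,1)$, a matrix $S\in\mathbb{R}^{p\times n}$ is an $\varepsilon$-subspace embedding for a subspace $\mathcal V\subset\mathbb{R}^n$ if $|\langle x,y\rangle-\langle Sx,Sy\rangle|\le\varepsilon\|x\|_2\|y\|_2$ for all $x,y\in\mathcal V$. A random $S\in\mathbb{R}^{p\times n}$ is an $(\varepsilon,d,m)$ oblivious $\ell_2$-subspace embedding if, for any fixed $m$-dimensional subspace $\mathcal V\subset\mathbb{R}^n$, it is an $\varepsilon$-subspace embedding for $\mathcal V$ with probability at least $1-d$. Probabilities are over the draw of the sketch matrices; $V$ is fixed. The norms of $S_1,S_2$ appearing in $\delta$ are those of the drawn matrices, for which $\delta\le1$ is assumed. Notation. $\sigma_1\ge\dots\ge\sigma_m$ are singular values, $\kappa(V)=\sigma_1(V)/\sigma_m(V)$, $\mathbf{u}$ is the unit roundoff, $\gamma_k=\frac{k\mathbf{u}}{1-k\mathbf{u}}$, $|A|$ is the entrywise absolute value (inequalities between such matrices are entrywise), hats denote computed quantities. Algorithm $\texttt{randQR}(V,S_1,S_2)$: (1) compute $W_1=S_1V$ and then $W=S_2W_1$; (2) compute a Householder QR factorization of $W$, keeping its $m\times m$ upper triangular factor $R$; (3) compute $Q=VR^{-1}$ by solving the triangular system $QR=V$ row by row. Output $Q,R$. Algorithm $\texttt{cholQR}(X)$: (1) compute $G=X^TX$; (2) compute the Cholesky factor $R$, $G=R^TR$;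 (3) compute $Q=XR^{-1}$ by solving $QR=X$ row by row. Output $Q,R$. Algorithm $\texttt{rand\_cholQR}(V,S_1,S_2)$: (1) $[Q_0,R_0]=\texttt{randQR}(V,S_1,S_2)$; (2) $[Q,R_1]=\texttt{cholQR}(Q_0)$; (3) $R=R_1R_0$. Output $Q,R$. Floating point. All steps are executed in the standard model of floating point arithmetic with unit roundoff $\mathbf{u}$ (each elementary operation has relative error at most $\mathbf{u}$, no overflow or underflow). The standard rounding error bounds for the subroutines are: a computed product of matrices $A,B$ with inner dimension $k$ is $AB+\Delta C$ with $|\Delta C|\le\gamma_k|A||B|$; Householder QR of $\hat W\in\mathbb{R}^{p_2\times m}$ returns upper triangular $\hat R$ for which there is a $Q_{tmp}\in\mathbb{R}^{p_2\times m}$ with exactly orthonormal columns and $\hat W+E_2=Q_{tmp}\hat R$, where $\|(E_2)_j\|_2\le\gamma_{29p_2m}\|\hat w_j\|_2$ for each column $j$; the row-wise solution of $Q\hat R=V$ returns $\hat Q$ with $\hat Q_{i,:}(\hat R+\Delta R_i)=V_{i,:}$, $|\Delta R_i|\le\gamma_m|\hat R|$, for each row $i$; the Cholesky factorization of a computed $\hat G\in\mathbb{R}^{m\times m}$ returns $\hat R$ with $\hat R^T\hat R=\hat G+E$, $|E|\le\gamma_{m+1}|\hat R|^T|\hat R|$. *)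

theory Defs
  imports "HOL-Probability.Probability"
begin

text \<open>
  A matrix with rows indexed by \<open>'r\<close> and columns indexed by \<open>'c\<close> has type \<open>real^'c^'r\<close>,
  also written \<open>('c, 'r) rmat\<close> (columns first).  On this type the library's \<open>\<bar>A\<bar>\<close> and \<open>A \<le> B\<close> are
  entrywise, and its norm is the Euclidean norm of all entries, i.e. the Frobenius norm.
\<close>

type_synonym ('c, 'r) rmat = "((real, 'c) vec, 'r) vec"

abbreviation frobenius_norm :: "real^'c^'r \<Rightarrow> real" where
  "frobenius_norm A \<equiv> norm A"

abbreviation spectral_norm :: "real^'c^'r \<Rightarrow> real" where
  "spectral_norm A \<equiv> onorm ((*v) A)"

text \<open>
  Singular values as square roots of the eigenvalues of \<open>A\<^sup>TA\<close>.  As a set this forgets multiplicities;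
  for matrices with at least as many rows as columns its largest and smallest elements are
  \<open>\<sigma>\<^sub>1\<close> and \<open>\<sigma>\<^sub>m\<close>, \<open>m\<close> being the number of columns.
\<close>

definition singular_values :: "real^'c^'r \<Rightarrow> real set" where
  "singular_values A =
     {sqrt l | l. \<exists>x. x \<noteq> 0 \<and> (transpose A ** A) *v x = l *\<^sub>R x}"

definition sigma_max :: "real^'c^'r \<Rightarrow> real" where
  "sigma_max A = Max (singular_values A)"

definition sigma_min :: "real^'c^'r \<Rightarrow> real" where
  "sigma_min A = Min (singular_values A)"

definition cond_number :: "real^'c^'r \<Rightarrow> real" where
  "cond_number A = sigma_max A / sigma_min A"

definition upper_triangular :: "('m::{finite,linorder}, 'm) rmat \<Rightarrow> bool" where
  "upper_triangular R \<longleftrightarrow> (\<forall>i j. j < i \<longrightarrow> R $ i $ j = 0)"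

definition subspace_embedding :: "real \<Rightarrow> real^'n^'p \<Rightarrow> (real^'n) set \<Rightarrow> bool" where
  "subspace_embedding \<epsilon> S V \<longleftrightarrow>
     (\<forall>x\<in>V. \<forall>y\<in>V. \<bar>x \<bullet> y - (S *v x) \<bullet> (S *v y)\<bar> \<le> \<epsilon> * norm x * norm y)"

definition oblivious_subspace_embedding ::
  "'w measure \<Rightarrow> ('w \<Rightarrow> real^'n^'p) \<Rightarrow> real \<Rightarrow> real \<Rightarrow> nat \<Rightarrow> bool" where
  "oblivious_subspace_embedding M S \<epsilon> d m \<longleftrightarrow>
     S \<in> borel_measurable M \<and>
     (\<forall>V. subspace V \<and> dim V = m \<longrightarrow>
        measure M {\<omega> \<in> space M. subspace_embedding \<epsilon> (S \<omega>) V} \<ge> 1 - d)"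

text \<open>
  Floating point execution is nondeterministic: each predicate below describes the results that
  a subroutine may return in the standard model with unit roundoff \<open>u\<close>, as delimited by its
  standard rounding error bound.  The computed matrices are the last arguments.
\<close>

definition gam :: "real \<Rightarrow> nat \<Rightarrow> real" where
  "gam u k = real k * u / (1 - real k * u)"

definition fl_product :: "real \<Rightarrow> real^'k^'r \<Rightarrow> real^'c^'k \<Rightarrow> real^'c^'r \<Rightarrow> bool" where
  "fl_product u A B C \<longleftrightarrow>
     (\<exists>\<Delta>C. C = A ** B + \<Delta>C \<and> \<bar>\<Delta>C\<bar> \<le> gam u CARD('k) *\<^sub>R (\<bar>A\<bar> ** \<bar>B\<bar>))"

definition fl_householder ::
  "real \<Rightarrow> ('m::{finite,linorder}, 'p::finite) rmat \<Rightarrow> ('m, 'm) rmat \<Rightarrow> bool" where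
  "fl_householder u W R \<longleftrightarrow>
     upper_triangular R \<and>
     (\<exists>Qtmp E.
        transpose Qtmp ** Qtmp = mat 1 \<and>
        W + E = Qtmp ** R \<and>
        (\<forall>j. norm (column j E) \<le> gam u (29 * CARD('p) * CARD('m)) * norm (column j W)))"

text \<open>Row-wise solution of \<open>QR = V\<close>; the perturbation of \<open>R\<close> may differ from row to row.\<close>

definition fl_row_solve ::
  "real \<Rightarrow> ('m::{finite,linorder}, 'n::finite) rmat \<Rightarrow> ('m, 'm) rmat \<Rightarrow> ('m, 'n) rmat \<Rightarrow> bool" where
  "fl_row_solve u V R Q \<longleftrightarrow>
     (\<forall>i. \<exists>\<Delta>R. row i Q v* (R + \<Delta>R) = row i V \<and> \<bar>\<Delta>R\<bar> \<le> gam u CARD('m) *\<^sub>R \<bar>R\<bar>)"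

definition fl_cholesky ::
  "real \<Rightarrow> ('m::{finite,linorder}, 'm) rmat \<Rightarrow> ('m, 'm) rmat \<Rightarrow> bool" where
  "fl_cholesky u G R \<longleftrightarrow>
     upper_triangular R \<and>
     (\<exists>E. transpose R ** R = G + E \<and>
          \<bar>E\<bar> \<le> gam u (CARD('m) + 1) *\<^sub>R (transpose \<bar>R\<bar> ** \<bar>R\<bar>))"

definition fl_randQR ::
  "real \<Rightarrow> ('m::{finite,linorder}, 'n::finite) rmat \<Rightarrow> real^'n^'p1 \<Rightarrow> real^'p1^'p2
     \<Rightarrow> ('m, 'n) rmat \<Rightarrow> ('m, 'm) rmat \<Rightarrow> bool" where
  "fl_randQR u V S1 S2 Q R \<longleftrightarrow>
     (\<exists>W1 W. fl_product u S1 V W1 \<and> fl_product u S2 W1 W \<and>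
             fl_householder u W R \<and> fl_row_solve u V R Q)"

definition fl_cholQR ::
  "real \<Rightarrow> ('m::{finite,linorder}, 'n::finite) rmat
     \<Rightarrow> ('m, 'n) rmat \<Rightarrow> ('m, 'm) rmat \<Rightarrow> bool" where
  "fl_cholQR u X Q R \<longleftrightarrow>
     (\<exists>G. fl_product u (transpose X) X G \<and> fl_cholesky u G R \<and> fl_row_solve u X R Q)"

definition fl_rand_cholQR ::
  "real \<Rightarrow> ('m::{finite,linorder}, 'n::finite) rmat \<Rightarrow> real^'n^'p1 \<Rightarrow> real^'p1^'p2
     \<Rightarrow> ('m, 'n) rmat \<Rightarrow> ('m, 'm) rmat \<Rightarrow> bool" where
  "fl_rand_cholQR u V S1 S2 Q R \<longleftrightarrow>
     (\<exists>Q0 R0 R1. fl_randQR u V S1 S2 Q0 R0 \<and> fl_cholQR u Q0 Q R1 \<and> fl_product u R1 R0 R)"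

end

theory Submission
  imports Defs
begin

text \<open>
  On the event that \<open>S\<^sub>1\<close> embeds the range of \<open>V\<close> and \<open>S\<^sub>2\<close> embeds its image, which has probability at
  least \<open>(1 - d\<^sub>1)(1 - d\<^sub>2)\<close> by independence and Fubini, everything is deterministic.  Put
  \<open>a = sqrt (1 - \<epsilon>L)\<close> and \<open>b = sqrt (1 + \<epsilon>H)\<close>.  The computed \<open>R\<^sub>0\<close> is an exact \<open>R\<close>-factor
  of \<open>S\<^sub>2S\<^sub>1V + F\<close> with \<open>\<parallel>F\<parallel>\<^sub>F \<le> a \<sigma>\<^sub>m \<delta> / 12\<close>, so that \<open>Q\<^sub>0 \<approx> V R\<^sub>0\<^sup>-\<^sup>1\<close> has all its
  singular values between \<open>0.9 / b\<close> and \<open>1.1 / a\<close>.  The Cholesky QR step then satisfies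
  \<open>R\<^sub>1\<^sup>TR\<^sub>1 = Q\<^sub>0\<^sup>TQ\<^sub>0 + E\<close> with \<open>\<parallel>E\<parallel>\<^sub>F \<le> \<eta> (0.9 / b)\<^sup>2\<close> and \<open>\<eta> < 1/3\<close>, which makes \<open>Q\<close> orthonormal up to a
  multiple of \<open>\<eta>\<close>.  The factorization error is
  \<open>V - QR = (V - Q\<^sub>0R\<^sub>0) + (Q\<^sub>0 - QR\<^sub>1)R\<^sub>0 - Q(R - R\<^sub>1R\<^sub>0)\<close>, with three summands of size \<open>O(m\<^sup>2 u) \<parallel>R\<^sub>0\<parallel>\<close>.
\<close>

section \<open>Matrix norms and subroutine errors\<close>

lemma norm_matrix_squared_rows:
  fixes A :: "real^'c^'r"
  shows "(norm A)\<^sup>2 = (\<Sum>i\<in>UNIV. (norm (A $ i))\<^sup>2)"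
  by (simp add: norm_vec_def L2_set_def sum_nonneg)

lemma norm_matrix_squared:
  fixes A :: "real^'c^'r"
  shows "(norm A)\<^sup>2 = (\<Sum>i\<in>UNIV. \<Sum>j\<in>UNIV. (A $ i $ j)\<^sup>2)"
  by (simp add: norm_vec_def L2_set_def sum_nonneg)

lemma norm_transpose:
  fixes A :: "real^'c^'r"
  shows "norm (transpose A) = norm A"
proof -
  have "(norm (transpose A))\<^sup>2 = (norm A)\<^sup>2"
    unfolding norm_matrix_squared transpose_def vec_lambda_beta by (rule sum.swap)
  then show ?thesis by simp
qed

lemma norm_matrix_squared_columns:
  fixes A :: "real^'c^'r"
  shows "(norm A)\<^sup>2 = (\<Sum>j\<in>UNIV. (norm (column j A))\<^sup>2)"
proof -
  have "transpose A $ j = column j A" for j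
    by (simp add: transpose_def column_def)
  then show ?thesis
    using norm_matrix_squared_rows [of "transpose A"] by (simp add: norm_transpose)
qed

lemma norm_abs_matrix:
  fixes A :: "real^'c^'r"
  shows "norm \<bar>A\<bar> = norm A"
proof -
  have "(norm \<bar>A\<bar>)\<^sup>2 = (norm A)\<^sup>2"
    unfolding norm_matrix_squared by (simp add: abs_vec_def)
  then show ?thesis by simp
qed

lemma norm_matrix_mono_entrywise:
  fixes A B :: "real^'c^'r"
  assumes "\<bar>A\<bar> \<le> B"
  shows "norm A \<le> norm B"
proof -
  have "norm (A $ i) \<le> norm (B $ i)" for i
  proof (rule norm_le_componentwise_cart)
    fix j
    have "\<bar>A $ i $ j\<bar> \<le> B $ i $ j"
      using assms by (simp add: less_eq_vec_def abs_vec_def)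
    then show "norm (A $ i $ j) \<le> norm (B $ i $ j)" by simp
  qed
  then show ?thesis by (rule norm_le_componentwise_cart)
qed

lemma norm_matrix_vector_le:
  fixes A :: "real^'c^'r"
  shows "norm (A *v x) \<le> norm A * norm x"
proof -
  have "(norm (A *v x))\<^sup>2 = (\<Sum>i\<in>UNIV. (A $ i \<bullet> x)\<^sup>2)"
    by (simp add: norm_vec_def L2_set_def sum_nonneg matrix_vector_mul_component)
  also have "\<dots> \<le> (\<Sum>i\<in>UNIV. (norm (A $ i))\<^sup>2 * (norm x)\<^sup>2)"
    by (rule sum_mono) (metis Cauchy_Schwarz_ineq power2_norm_eq_inner)
  also have "\<dots> = (norm A * norm x)\<^sup>2"
    by (simp add: norm_matrix_squared_rows sum_distrib_right power_mult_distrib)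
  finally show ?thesis
    by (rule power2_le_imp_le) simp
qed

lemma norm_le_spectral_norm:
  fixes A :: "real^'c^'r"
  shows "norm (A *v x) \<le> spectral_norm A * norm x"
  by (rule onorm) simp

lemma spectral_norm_nonneg:
  fixes A :: "real^'c^'r"
  shows "0 \<le> spectral_norm A"
  by (rule onorm_pos_le) simp

lemma spectral_norm_le_norm:
  fixes A :: "real^'c^'r"
  shows "spectral_norm A \<le> norm A"
  by (rule onorm_le) (rule norm_matrix_vector_le)

text \<open>Testing against \<open>y = A *v x\<close> and cancelling one factor
  \<open>norm (A *v x)\<close> gives the operator bound. This suits the orthogonality error, which
  is estimated below as a bilinear form.\<close>

lemma spectral_norm_leI_bilinear:
  fixes A :: "real^'c^'r"
  assumes "0 \<le> C" "\<And>x y. \<bar>(A *v x) \<bullet> y\<bar> \<le> C * norm x * norm y"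
  shows "spectral_norm A \<le> C"
proof (rule onorm_le)
  fix x
  have "norm (A *v x) * norm (A *v x) \<le> C * norm x * norm (A *v x)"
    using assms(2) [of x "A *v x"] by (simp add: power2_norm_eq_inner flip: power2_eq_square)
  then show "norm (A *v x) \<le> C * norm x"
    by (cases "A *v x = 0") (use assms(1) in auto)
qed

lemma column_matrix_mult:
  fixes A :: "real^'k^'r" and B :: "real^'c^'k"
  shows "column j (A ** B) = A *v column j B"
  by (simp add: vec_eq_iff column_def matrix_matrix_mult_def matrix_vector_mult_def)

text \<open>Squared Frobenius norms add over columns, and each column of \<open>A ** B\<close> is
  \<open>A\<close> applied to a column of \<open>B\<close>, so a bound for all vectors passes to the
  columns. The separate matrix \<open>C\<close> lets embedding bounds relative to
  \<open>V *v x\<close> transfer to Frobenius norms without a dimensional factor; with identity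
  matrices inserted it yields the \<open>sqrt\<close> bounds below.\<close>

lemma norm_matrix_mult_le_bound:
  fixes A :: "real^'k^'r" and B :: "real^'c^'k" and C :: "real^'c^'l"
  assumes "0 \<le> c" "\<And>x. norm (A *v (B *v x)) \<le> c * norm (C *v x)"
  shows "norm (A ** B) \<le> c * norm C"
proof -
  have "(norm (A ** B))\<^sup>2 = (\<Sum>j\<in>UNIV. (norm (A *v column j B))\<^sup>2)"
    by (simp add: norm_matrix_squared_columns column_matrix_mult)
  also have "\<dots> \<le> (\<Sum>j\<in>UNIV. (c * norm (column j C))\<^sup>2)"
    using assms(2) by (intro sum_mono power_mono) (simp_all flip: matrix_vector_mult_basis)
  also have "\<dots> = (c * norm C)\<^sup>2"
    by (simp add: norm_matrix_squared_columns sum_distrib_left power_mult_distrib)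
  finally show ?thesis
    by (rule power2_le_imp_le) (simp add: assms)
qed

lemma norm_matrix_mult_le_spectral:
  fixes A :: "real^'k^'r" and B :: "real^'c^'k"
  shows "norm (A ** B) \<le> spectral_norm A * norm B"
  by (intro norm_matrix_mult_le_bound norm_le_spectral_norm spectral_norm_nonneg)

lemma norm_matrix_mult_le:
  fixes A :: "real^'k^'r" and B :: "real^'c^'k"
  shows "norm (A ** B) \<le> norm A * norm B"
  by (intro norm_matrix_mult_le_bound norm_matrix_vector_le) simp

lemma norm_mat_1: "norm (mat 1 :: real^'c^'c) = sqrt (real CARD('c))"
proof -
  have "(norm (mat 1 :: real^'c^'c))\<^sup>2 = (\<Sum>i\<in>(UNIV :: 'c set). \<Sum>j\<in>UNIV. if i = j then 1 else 0)"
    unfolding norm_matrix_squared by (intro sum.cong) (auto simp: mat_def)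
  then show ?thesis
    by (simp add: real_sqrt_unique)
qed

lemma norm_matrix_le_sqrt_columns:
  fixes A :: "real^'c^'r"
  assumes "0 \<le> K" "\<And>x. norm (A *v x) \<le> K * norm x"
  shows "norm A \<le> K * sqrt (real CARD('c))"
proof -
  have "norm (A ** mat 1) \<le> K * norm (mat 1 :: real^'c^'c)"
    by (rule norm_matrix_mult_le_bound) (simp_all add: assms)
  then show ?thesis by (simp add: norm_mat_1)
qed

lemma norm_matrix_ge_sqrt_columns:
  fixes A :: "real^'c^'r"
  assumes "0 < K" "\<And>x. K * norm x \<le> norm (A *v x)"
  shows "K * sqrt (real CARD('c)) \<le> norm A"
proof -
  have "norm (mat 1 ** (mat 1 :: real^'c^'c)) \<le> 1 / K * norm A"
    by (rule norm_matrix_mult_le_bound) (use assms in \<open>simp_all add: field_simps\<close>)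
  then show ?thesis using assms(1) by (simp add: norm_mat_1 field_simps)
qed

text \<open>With \<open>z = transpose A *v y\<close>, moving \<open>A\<close> across the inner
  product turns the square of \<open>norm z\<close> into \<open>y \<bullet> (A *v z)\<close>;
  Cauchy-Schwarz then leaves a factor \<open>norm z\<close> to cancel.\<close>

lemma norm_transpose_vector_le:
  fixes A :: "real^'c^'r"
  assumes "0 \<le> K" "\<And>x. norm (A *v x) \<le> K * norm x"
  shows "norm (transpose A *v y) \<le> K * norm y"
proof -
  let ?z = "transpose A *v y"
  have "norm ?z * norm ?z = y \<bullet> (A *v ?z)"
    by (metis dot_lmul_matrix power2_eq_square power2_norm_eq_inner transpose_matrix_vector)
  also have "\<dots> \<le> norm y * (K * norm ?z)"
    by (meson assms(2) mult_left_mono norm_cauchy_schwarz norm_ge_zero order_trans)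
  finally have "norm ?z * norm ?z \<le> (K * norm y) * norm ?z" by (simp add: mult_ac)
  then show ?thesis
    by (cases "?z = 0") (use assms(1) in auto)
qed

text \<open>The column bound applied to the transpose. For \<open>S2\<close>, which has no more rows
  than columns, this is the origin of the \<open>sqrt p2\<close> in \<open>\<delta>\<close>.\<close>

lemma norm_matrix_le_sqrt_rows:
  fixes A :: "real^'c^'r"
  shows "norm A \<le> spectral_norm A * sqrt (real CARD('r))"
proof -
  have "norm (transpose A) \<le> spectral_norm A * sqrt (real CARD('r))"
    by (intro norm_matrix_le_sqrt_columns norm_transpose_vector_le norm_le_spectral_norm
        spectral_norm_nonneg)
  then show ?thesis by (simp add: norm_transpose)
qed

lemma norm_matrix_mult_le_spectral_right:
  fixes A :: "real^'k^'r" and B :: "real^'c^'k"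
  assumes "0 \<le> N" "\<And>x. norm (B *v x) \<le> N * norm x"
  shows "norm (A ** B) \<le> norm A * N"
proof -
  have "norm (transpose B ** transpose A) \<le> N * norm (transpose A)"
    by (rule norm_matrix_mult_le_bound) (use assms norm_transpose_vector_le in blast)+
  then show ?thesis
    by (simp add: matrix_transpose_mul [symmetric] norm_transpose mult.commute)
qed

lemma norm_le_abs_product:
  fixes A :: "real^'k^'r" and B :: "real^'c^'k" and E :: "real^'c^'r"
  assumes "\<bar>E\<bar> \<le> c *\<^sub>R (\<bar>A\<bar> ** \<bar>B\<bar>)" "0 \<le> c"
  shows "norm E \<le> c * (norm A * norm B)"
proof -
  have "norm E \<le> c * norm (\<bar>A\<bar> ** \<bar>B\<bar>)"
    using norm_matrix_mono_entrywise [OF assms(1)] assms(2) by simp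
  also have "\<dots> \<le> c * (norm A * norm B)"
    using norm_matrix_mult_le [of "\<bar>A\<bar>" "\<bar>B\<bar>"] assms(2)
    by (simp add: norm_abs_matrix mult_left_mono)
  finally show ?thesis .
qed

section \<open>Rounding errors of the subroutines in the Frobenius norm\<close>

lemma fl_product_error:
  fixes A :: "real^'k^'r" and B C :: "real^_^_"
  assumes "fl_product u A B C" "0 \<le> gam u CARD('k)"
  obtains E where "C = A ** B + E" "norm E \<le> gam u CARD('k) * (norm A * norm B)"
  using assms norm_le_abs_product unfolding fl_product_def by metis

text \<open>A factor with orthonormal columns preserves norms, so \<open>R\<close> may be replaced
  by \<open>W + E\<close> in every norm estimate and the orthogonal factor disappears. The
  columnwise errors add up in squares to a Frobenius bound.\<close>

lemma fl_householder_error: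
  fixes W :: "real^('m::{finite,linorder})^('p::finite)"
  assumes "fl_householder u W R" "0 \<le> gam u (29 * CARD('p) * CARD('m))"
  obtains E where "\<And>x. norm (R *v x) = norm ((W + E) *v x)"
    "norm E \<le> gam u (29 * CARD('p) * CARD('m)) * norm W"
proof -
  let ?g = "gam u (29 * CARD('p) * CARD('m))"
  from assms obtain P E where P: "transpose P ** P = mat 1" and WE: "W + E = P ** R"
    and E: "\<And>j. norm (column j E) \<le> ?g * norm (column j W)"
    unfolding fl_householder_def by blast
  have iso: "norm (P *v y) = norm y" for y
  proof -
    have "(P *v y) \<bullet> (P *v y) = y \<bullet> (transpose P *v (P *v y))"
      by (metis dot_lmul_matrix inner_commute transpose_matrix_vector)
    also have "\<dots> = y \<bullet> y"
      by (simp add: P matrix_vector_mul_assoc)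
    finally show ?thesis by (simp add: norm_eq_sqrt_inner)
  qed
  have "(norm E)\<^sup>2 \<le> (\<Sum>j\<in>UNIV. (?g * norm (column j W))\<^sup>2)"
    unfolding norm_matrix_squared_columns by (intro sum_mono power_mono E) simp
  also have "\<dots> = (?g * norm W)\<^sup>2"
    by (simp add: norm_matrix_squared_columns sum_distrib_left power_mult_distrib)
  finally have "norm E \<le> ?g * norm W"
    by (rule power2_le_imp_le) (simp add: assms)
  moreover have "norm (R *v x) = norm ((W + E) *v x)" for x
    unfolding WE by (metis iso matrix_vector_mul_assoc)
  ultimately show thesis using that by blast
qed

text \<open>The perturbation of \<open>R\<close> changes from row to row, so there is no single
  perturbed system. Row \<open>i\<close> of the residual is however row \<open>i\<close> of
  \<open>Q\<close> times its own perturbation, and all perturbations obey the same bound, so the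
  backward errors merge into one residual.\<close>

lemma fl_row_solve_error:
  fixes V Q :: "real^('m::{finite,linorder})^('n::finite)"
  assumes "fl_row_solve u V R Q" "0 \<le> gam u CARD('m)"
  shows "norm (V - Q ** R) \<le> gam u CARD('m) * (norm Q * norm R)"
proof (rule norm_le_abs_product)
  let ?g = "gam u CARD('m)"
  have "\<bar>(V - Q ** R) $ i $ j\<bar> \<le> ?g * (\<bar>Q\<bar> ** \<bar>R\<bar>) $ i $ j" for i j
  proof -
    from assms(1) obtain D where D: "row i Q v* (R + D) = row i V" and "\<bar>D\<bar> \<le> ?g *\<^sub>R \<bar>R\<bar>"
      unfolding fl_row_solve_def by blast
    then have Dk: "\<bar>D $ k $ j\<bar> \<le> ?g * \<bar>R $ k $ j\<bar>" for k
      by (simp add: less_eq_vec_def abs_vec_def)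
    have "V $ i $ j = (\<Sum>k\<in>UNIV. (R + D) $ k $ j * Q $ i $ k)"
      using arg_cong [OF D, of "\<lambda>v. v $ j"] by (simp add: row_def vector_matrix_mult_def mult.commute)
    then have "(V - Q ** R) $ i $ j = (\<Sum>k\<in>UNIV. D $ k $ j * Q $ i $ k)"
      by (simp add: matrix_matrix_mult_def algebra_simps sum.distrib)
    also have "\<bar>\<dots>\<bar> \<le> (\<Sum>k\<in>UNIV. \<bar>D $ k $ j * Q $ i $ k\<bar>)"
      by (rule sum_abs)
    also have "\<dots> \<le> (\<Sum>k\<in>UNIV. ?g * \<bar>R $ k $ j\<bar> * \<bar>Q $ i $ k\<bar>)"
      by (intro sum_mono) (simp add: abs_mult Dk mult_right_mono)
    finally show ?thesis
      by (simp add: matrix_matrix_mult_def abs_vec_def sum_distrib_left mult_ac)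
  qed
  then show "\<bar>V - Q ** R\<bar> \<le> ?g *\<^sub>R (\<bar>Q\<bar> ** \<bar>R\<bar>)"
    by (simp add: less_eq_vec_def abs_vec_def)
qed (rule assms)

lemma trace_transpose_mult:
  fixes A :: "real^'c^'r"
  shows "trace (transpose A ** A) = (norm A)\<^sup>2"
  unfolding trace_def norm_matrix_squared
  by (subst sum.swap) (simp add: matrix_matrix_mult_def transpose_def power2_eq_square)

lemma trace_le_of_entrywise:
  fixes E :: "real^'c^'c" and A :: "real^'c^'r"
  assumes "\<bar>E\<bar> \<le> c *\<^sub>R (transpose \<bar>A\<bar> ** \<bar>A\<bar>)"
  shows "trace E \<le> c * (norm A)\<^sup>2"
proof -
  have "trace E \<le> trace (c *\<^sub>R (transpose \<bar>A\<bar> ** \<bar>A\<bar>))"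
    unfolding trace_def
  proof (rule sum_mono)
    fix i
    have "\<bar>E $ i $ i\<bar> \<le> (c *\<^sub>R (transpose \<bar>A\<bar> ** \<bar>A\<bar>)) $ i $ i"
      using assms by (simp add: less_eq_vec_def abs_vec_def)
    then show "E $ i $ i \<le> (c *\<^sub>R (transpose \<bar>A\<bar> ** \<bar>A\<bar>)) $ i $ i" by linarith
  qed
  also have "\<dots> = c * trace (transpose \<bar>A\<bar> ** \<bar>A\<bar>)"
    by (simp add: trace_def sum_distrib_left)
  finally show ?thesis by (simp add: trace_transpose_mult norm_abs_matrix)
qed

text \<open>
  The trace identity \<open>tr R\<^sup>TR = \<parallel>R\<parallel>\<^sub>F\<^sup>2\<close> controls \<open>R\<close> although the Cholesky residual
  is bounded in terms of \<open>R\<close> itself.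
\<close>

lemma fl_cholesky_error:
  fixes X :: "real^('m::{finite,linorder})^('n::finite)"
  assumes "fl_product u (transpose X) X G" "fl_cholesky u G R"
    and "0 \<le> gam u CARD('n)" "0 \<le> gam u (CARD('m) + 1)" "gam u (CARD('m) + 1) < 1"
  obtains E where "transpose R ** R = transpose X ** X + E"
    "(norm R)\<^sup>2 \<le> (1 + gam u CARD('n)) / (1 - gam u (CARD('m) + 1)) * (norm X)\<^sup>2"
    "norm E \<le> gam u CARD('n) * (norm X)\<^sup>2 + gam u (CARD('m) + 1) * (norm R)\<^sup>2"
proof -
  let ?g = "gam u CARD('n)" and ?h = "gam u (CARD('m) + 1)"
  have absT: "\<bar>transpose A\<bar> = transpose \<bar>A\<bar>" for A :: "real^'c^'d"
    by (simp add: vec_eq_iff transpose_def abs_vec_def)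
  from assms(1) obtain E1 where G: "G = transpose X ** X + E1"
    and E1: "\<bar>E1\<bar> \<le> ?g *\<^sub>R (transpose \<bar>X\<bar> ** \<bar>X\<bar>)"
    unfolding fl_product_def absT by blast
  from assms(2) obtain E2 where RR: "transpose R ** R = G + E2"
    and E2: "\<bar>E2\<bar> \<le> ?h *\<^sub>R (transpose \<bar>R\<bar> ** \<bar>R\<bar>)"
    unfolding fl_cholesky_def by blast
  have "(norm R)\<^sup>2 = trace (transpose X ** X) + trace E1 + trace E2"
    unfolding trace_transpose_mult [symmetric] RR G by (simp only: trace_add)
  also have "\<dots> \<le> (norm X)\<^sup>2 + ?g * (norm X)\<^sup>2 + ?h * (norm R)\<^sup>2"
    using trace_le_of_entrywise [OF E1] trace_le_of_entrywise [OF E2]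
    by (simp add: trace_transpose_mult)
  finally have R: "(norm R)\<^sup>2 \<le> (1 + ?g) / (1 - ?h) * (norm X)\<^sup>2"
    using assms(5) by (simp add: field_simps)
  have "norm (E1 + E2) \<le> norm E1 + norm E2"
    by (rule norm_triangle_ineq)
  also have "norm E1 \<le> ?g * (norm X)\<^sup>2"
    using norm_le_abs_product [OF E1 [folded absT]] assms(3)
    by (simp add: norm_transpose power2_eq_square)
  also have "norm E2 \<le> ?h * (norm R)\<^sup>2"
    using norm_le_abs_product [OF E2 [folded absT]] assms(4)
    by (simp add: norm_transpose power2_eq_square)
  finally show thesis
    using that [of "E1 + E2"] R by (simp add: RR G add_ac)
qed

section \<open>Extremal singular values\<close>

text \<open>A variational argument: if \<open>h x\<close> were nonzero, a short step from
  \<open>x\<close> against the direction \<open>h x\<close> would make the quadratic form negative,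
  since it starts at zero with slope \<open>-2 * n\<close>.\<close>

lemma psd_kernel:
  fixes h :: "'a::real_inner \<Rightarrow> 'a"
  assumes "linear h" and sym: "\<And>x y. h x \<bullet> y = x \<bullet> h y" and pos: "\<And>x. 0 \<le> h x \<bullet> x"
    and zero: "h x \<bullet> x = 0"
  shows "h x = 0"
proof (rule ccontr)
  assume "h x \<noteq> 0"
  define z c n where "z = h x" and "c = h z \<bullet> z" and "n = z \<bullet> z"
  \<comment> \<open>The quadratic form along the step is \<open>s * (s * c - 2 * n)\<close>, minimal
    at \<open>n / c\<close>; the \<open>+ 1\<close> keeps the denominator positive when
    \<open>c = 0\<close>.\<close>
  define s where "s = n / (c + 1)"
  have n: "n > 0" using \<open>h x \<noteq> 0\<close> by (simp add: n_def z_def)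
  have c: "c \<ge> 0" using pos by (simp add: c_def)
  interpret h: linear h by fact
  have hxz: "h x \<bullet> z = n" by (simp add: n_def z_def)
  have "h (x - s *\<^sub>R z) \<bullet> (x - s *\<^sub>R z) = h x \<bullet> x - s * (h x \<bullet> z) - s * (h z \<bullet> x) + s * s * c"
    by (simp add: h.diff h.scaleR inner_diff_left inner_diff_right c_def algebra_simps)
  also have "h z \<bullet> x = n"
    by (simp add: sym n_def z_def)
  finally have "h (x - s *\<^sub>R z) \<bullet> (x - s *\<^sub>R z) = s * (s * c - 2 * n)"
    by (simp add: zero hxz algebra_simps)
  moreover have "s > 0" using n c by (simp add: s_def)
  moreover have "s * c < 2 * n"
    using n c by (simp add: s_def field_simps add_strict_increasing)
  ultimately have "h (x - s *\<^sub>R z) \<bullet> (x - s *\<^sub>R z) < 0"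
    by (simp add: mult_pos_neg)
  then show False using pos [of "x - s *\<^sub>R z"] by linarith
qed

lemma transpose_mult_inner:
  fixes A :: "real^'c^'r" and B :: "real^'d^'r"
  shows "((transpose A ** B) *v x) \<bullet> y = (B *v x) \<bullet> (A *v y)"
  by (metis dot_lmul_matrix inner_commute matrix_vector_mul_assoc transpose_matrix_vector)

text \<open>Eigenvectors of a symmetric matrix for distinct eigenvalues are orthogonal, hence
  independent, so there are finitely many of them. Finiteness gives \<open>Max\<close> and
  \<open>Min\<close> in \<open>sigma_max\<close> and \<open>sigma_min\<close> their meaning.\<close>

lemma finite_singular_values:
  fixes A :: "real^'c^'r"
  shows "finite (singular_values A)"
proof -
  let ?G = "transpose A ** A"
  define L where "L = {l. \<exists>x. x \<noteq> 0 \<and> ?G *v x = l *\<^sub>R x}"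
  have "\<forall>l\<in>L. \<exists>x. x \<noteq> 0 \<and> ?G *v x = l *\<^sub>R x" by (simp add: L_def)
  then obtain e where e: "\<And>l. l \<in> L \<Longrightarrow> e l \<noteq> 0 \<and> ?G *v e l = l *\<^sub>R e l"
    by (metis (no_types, lifting))
  have orth: "e k \<bullet> e l = 0" if "k \<in> L" "l \<in> L" "k \<noteq> l" for k l
  proof -
    have "k * (e k \<bullet> e l) = (?G *v e k) \<bullet> e l" using e that by simp
    also have "\<dots> = e k \<bullet> (?G *v e l)" by (metis inner_commute transpose_mult_inner)
    also have "\<dots> = l * (e k \<bullet> e l)" using e that by simp
    finally show ?thesis using \<open>k \<noteq> l\<close> by simp
  qed
  have "inj_on e L"
    by (rule inj_onI) (metis e inner_eq_zero_iff orth)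
  moreover have "finite (e ` L)"
  proof (rule independent_imp_finite, rule pairwise_orthogonal_independent)
    show "pairwise orthogonal (e ` L)"
      using orth by (auto simp: pairwise_def orthogonal_def)
    show "0 \<notin> e ` L" using e by force
  qed
  ultimately have "finite L" by (metis finite_image_iff)
  moreover have "singular_values A = sqrt ` L"
    unfolding singular_values_def L_def by auto
  ultimately show ?thesis by simp
qed

text \<open>The sign \<open>\<sigma>\<close> selects a minimum (\<open>1\<close>) or a maximum
  (\<open>-1\<close>) of the Rayleigh quotient at \<open>x\<close>. In both cases
  \<open>\<sigma>\<close> times \<open>transpose A ** A\<close> minus \<open>l\<close> times the
  identity is positive semidefinite with vanishing quadratic form at \<open>x\<close>, so
  \<open>psd_kernel\<close> makes \<open>x\<close> an eigenvector.\<close>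

lemma singular_value_extremal:
  fixes A :: "real^'c^'r"
  assumes "norm x = 1" "\<sigma> = 1 \<or> \<sigma> = -1"
    and ext: "\<And>y. 0 \<le> \<sigma> * ((norm (A *v y))\<^sup>2 - (norm (A *v x))\<^sup>2 * (norm y)\<^sup>2)"
  shows "norm (A *v x) \<in> singular_values A"
proof -
  define l where "l = (norm (A *v x))\<^sup>2"
  define h where "h = (\<lambda>y. \<sigma> *\<^sub>R ((transpose A ** A) *v y - l *\<^sub>R y))"
  have h_inner: "h y \<bullet> z = \<sigma> * ((A *v y) \<bullet> (A *v z) - l * (y \<bullet> z))" for y z
    by (simp add: h_def inner_diff_left transpose_mult_inner)
  have "h x = 0"
  proof (rule psd_kernel [of h x])
    show "linear h"
      unfolding h_def by (intro linearI) (simp_all add: algebra_simps matrix_vector_right_distrib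
          matrix_vector_mult_scaleR)
    show "h y \<bullet> z = y \<bullet> h z" for y z
      using h_inner by (metis inner_commute)
    show "0 \<le> h y \<bullet> y" for y
      using ext [of y] by (simp add: h_inner l_def power2_norm_eq_inner)
    show "h x \<bullet> x = 0"
      using assms(1) by (simp add: h_inner l_def flip: power2_norm_eq_inner)
  qed
  then have "(transpose A ** A) *v x = l *\<^sub>R x"
    using assms(2) by (auto simp: h_def)
  moreover have "x \<noteq> 0" using assms(1) by auto
  moreover have "norm (A *v x) = sqrt l" by (simp add: l_def)
  ultimately show ?thesis unfolding singular_values_def by blast
qed

text \<open>Compactness of the unit sphere gives the two extremal vectors; homogeneity extends the
  inequalities to all \<open>z\<close>.\<close>

lemma unit_sphere_attains:
  fixes A :: "real^'c^'r"
  obtains x y where "norm x = 1" "norm y = 1"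
    "\<And>z. norm (A *v x) * norm z \<le> norm (A *v z)" "\<And>z. norm (A *v z) \<le> norm (A *v y) * norm z"
proof -
  let ?S = "sphere (0 :: real^'c) 1"
  have ne: "?S \<noteq> {}" and c: "compact ?S" by simp_all
  have cont: "continuous_on ?S (\<lambda>z. norm (A *v z))"
    by (intro continuous_intros linear_continuous_on matrix_vector_mul_bounded_linear)
  obtain x where x: "x \<in> ?S" "\<And>z. z \<in> ?S \<Longrightarrow> norm (A *v x) \<le> norm (A *v z)"
    using continuous_attains_inf [OF c ne cont] by auto
  obtain y where y: "y \<in> ?S" "\<And>z. z \<in> ?S \<Longrightarrow> norm (A *v z) \<le> norm (A *v y)"
    using continuous_attains_sup [OF c ne cont] by auto
  have unit: "norm (A *v z) = norm (A *v ((1 / norm z) *\<^sub>R z)) * norm z" "(1 / norm z) *\<^sub>R z \<in> ?S"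
    if "z \<noteq> 0" for z
    using that by (simp_all add: matrix_vector_mult_scaleR)
  have "norm (A *v x) * norm z \<le> norm (A *v z)" "norm (A *v z) \<le> norm (A *v y) * norm z" for z
    by (cases "z = 0"; use unit x(2) y(2) in \<open>metis mult_right_mono norm_ge_zero norm_zero
      mult_zero_right matrix_vector_mult_0_right order_refl\<close>)+
  with x(1) y(1) show thesis by (intro that [of x y]) auto
qed

lemma sigma_min_le:
  fixes A :: "real^'c^'r"
  shows "sigma_min A * norm z \<le> norm (A *v z)"
proof -
  obtain x where x: "norm x = 1" "\<And>z. norm (A *v x) * norm z \<le> norm (A *v z)"
    using unit_sphere_attains by metis
  have "norm (A *v x) \<in> singular_values A"
    by (rule singular_value_extremal [where \<sigma> = 1])
      (use x in \<open>auto simp flip: power_mult_distrib\<close>)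
  then have "sigma_min A \<le> norm (A *v x)"
    by (simp add: sigma_min_def finite_singular_values)
  then show ?thesis
    using x(2) [of z] by (meson mult_right_mono norm_ge_zero order_trans)
qed

lemma spectral_norm_le_sigma_max:
  fixes A :: "real^'c^'r"
  shows "spectral_norm A \<le> sigma_max A"
proof -
  obtain y where y: "norm y = 1" "\<And>z. norm (A *v z) \<le> norm (A *v y) * norm z"
    using unit_sphere_attains by metis
  have "norm (A *v y) \<in> singular_values A"
    by (rule singular_value_extremal [where \<sigma> = "-1"])
      (use y in \<open>auto simp flip: power_mult_distrib\<close>)
  then have "norm (A *v y) \<le> sigma_max A"
    by (simp add: sigma_max_def finite_singular_values)
  moreover have "spectral_norm A \<le> norm (A *v y)"
    by (rule onorm_le) (rule y(2))
  ultimately show ?thesis by simp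
qed

text \<open>The extremal vector shows that the finite set of singular values is nonempty, so
  \<open>sigma_min A\<close> is itself a member \<open>sqrt l\<close>. For its eigenvector
  \<open>y\<close>, full rank gives \<open>A *v y \<noteq> 0\<close>, and the squared norm of
  \<open>A *v y\<close> is \<open>l * (y \<bullet> y)\<close>.\<close>

lemma sigma_min_pos:
  fixes A :: "real^'c^'r"
  assumes "rank A = CARD('c)"
  shows "0 < sigma_min A"
proof -
  obtain x where x: "norm x = 1" "\<And>z. norm (A *v x) * norm z \<le> norm (A *v z)"
    using unit_sphere_attains by metis
  have "norm (A *v x) \<in> singular_values A"
    by (rule singular_value_extremal [where \<sigma> = 1])
      (use x in \<open>auto simp flip: power_mult_distrib\<close>)
  then have "sigma_min A \<in> singular_values A"
    unfolding sigma_min_def using finite_singular_values by (intro Min_in) auto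
  then obtain l y where l: "sigma_min A = sqrt l" "y \<noteq> 0" "(transpose A ** A) *v y = l *\<^sub>R y"
    unfolding singular_values_def by blast
  have "A *v y \<noteq> 0"
    using assms l(2) by (metis matrix_nonfull_linear_equations_eq)
  then have "0 < (A *v y) \<bullet> (A *v y)" by simp
  also have "\<dots> = l * (y \<bullet> y)"
    using transpose_mult_inner [of A A y y] by (simp add: l(3))
  finally have "0 < l"
    using l(2) by (metis inner_gt_zero_iff zero_less_mult_pos2)
  then show ?thesis by (simp add: l(1))
qed

section \<open>Error analysis for a fixed sketch\<close>

text \<open>An a priori bound \<open>c\<close> on \<open>k * u\<close> makes \<open>gam\<close>
  linear in \<open>k * u\<close> up to a constant factor.\<close>

lemma gam_bounds:
  assumes "0 \<le> u" "real k * u \<le> c" "c < 1"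
  shows "0 \<le> gam u k" "gam u k \<le> real k * u / (1 - c)"
  using assms by (auto simp: gam_def intro!: divide_nonneg_pos divide_left_mono mult_pos_pos)

lemma norm_times_spectral_bounds:
  fixes A :: "real^'k^'r" and B :: "real^'c^'k"
  assumes "0 \<le> \<alpha>" "0 \<le> \<beta>" "\<And>x. norm (A *v x) \<le> \<alpha> * norm x" "\<And>x. norm (B *v x) \<le> \<beta> * norm x"
  shows "norm A * norm B \<le> \<alpha> * \<beta> * (sqrt (real CARD('k)) * sqrt (real CARD('c)))"
proof -
  have "norm A * norm B \<le> (\<alpha> * sqrt (real CARD('k))) * (\<beta> * sqrt (real CARD('c)))"
    using assms by (intro mult_mono norm_matrix_le_sqrt_columns) auto
  then show ?thesis by (simp add: mult_ac)
qed

text \<open>\<open>F\<close> collects three errors, one for each summand of \<open>\<delta>\<close>: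
  the first product, amplified by \<open>S2\<close>, gives the term with \<open>n * norm S1\<close>;
  the second product gives the one with \<open>p1 * sqrt p2 * c\<close>; Householder QR gives the
  one with \<open>b * p2\<close>.\<close>

lemma fl_sketch_QR:
  fixes V :: "real^('m::{finite,linorder})^('n::finite)"
    and S1 :: "real^'n^('p1::finite)" and S2 :: "real^'p1^('p2::finite)"
  assumes W1: "fl_product u S1 V W1" and W: "fl_product u S2 W1 W" and R: "fl_householder u W R"
    and V: "\<And>x. norm (V *v x) \<le> N * norm x"
    and S1V: "\<And>x. norm (S1 *v (V *v x)) \<le> c * norm (V *v x)"
    and S2V: "\<And>x. norm (S2 *v (S1 *v (V *v x))) \<le> b * norm (V *v x)"
    and nonneg: "0 \<le> N" "0 \<le> c" "0 \<le> b" "0 < u"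
    and n: "n = real CARD('n)" "n * u \<le> 1 / 24"
    and m: "m = real CARD('m)" and p1: "p1 = real CARD('p1)"
    and p2: "p2 = real CARD('p2)" "2 \<le> p2"
    and p12: "p1 * sqrt p2 * u \<le> 1 / 12" and p2m: "p2 * m * u \<le> 1 / 536"
  obtains F where "\<And>x. norm (R *v x) = norm ((S2 ** (S1 ** V) + F) *v x)"
    "norm F \<le> 383 / 12 * ((b * p2 * (m * sqrt m)
        + sqrt m * spectral_norm S2 * (p1 * sqrt p2 * c + n * norm S1)) * u * N)"
proof -
  let ?gn = "gam u CARD('n)" and ?gp = "gam u CARD('p1)" and ?gh = "gam u (29 * CARD('p2) * CARD('m))"
  define s where "s = spectral_norm S2"
  define L where "L = N * sqrt m"
  have s: "0 \<le> s" by (simp add: s_def spectral_norm_nonneg)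
  have L: "0 \<le> L" using nonneg m by (simp add: L_def)
  \<comment> \<open>A rational lower bound for \<open>sqrt 2\<close>; it turns \<open>1 / 12\<close>
    into \<open>5 / 84\<close> for \<open>p1 * u\<close>.\<close>
  have sqrt_p2: "1.4 \<le> sqrt p2"
    using p2(2) by (intro real_le_rsqrt) (simp add: power2_eq_square)
  have "p1 * 1.4 * u \<le> p1 * sqrt p2 * u"
    using sqrt_p2 nonneg p1 by (intro mult_right_mono mult_left_mono) auto
  then have p1u: "p1 * u \<le> 5 / 84" using p12 by simp
  \<comment> \<open>The factors \<open>21 / 20\<close>, \<open>107 / 100\<close> and
    \<open>30.74\<close> round up \<open>24 / 23\<close>, \<open>84 / 79\<close> and
    \<open>29 * 536 / 507\<close>.\<close>
  have gn: "0 \<le> ?gn" "?gn \<le> 21 / 20 * (n * u)"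
    using gam_bounds [of u "CARD('n)" "1/24"] nonneg n by auto
  have gp: "0 \<le> ?gp" "?gp \<le> 107 / 100 * (p1 * u)"
    using gam_bounds [of u "CARD('p1)" "5/84"] nonneg p1 p1u by auto
  have gh: "0 \<le> ?gh" "?gh \<le> 30.74 * (p2 * m * u)"
  proof -
    have k: "real (29 * CARD('p2) * CARD('m)) * u = 29 * (p2 * m * u)"
      by (simp add: p2 m)
    moreover have "real (29 * CARD('p2) * CARD('m)) * u \<le> 29/536"
      unfolding k using p2m by linarith
    moreover have "0 \<le> p2 * m * u" using nonneg p2 m by simp
    ultimately have "0 \<le> ?gh" "?gh \<le> 29 * (p2 * m * u) / (1 - 29 / 536)"
      using gam_bounds [of u "29 * CARD('p2) * CARD('m)" "29/536"] nonneg unfolding k by simp_all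
    moreover have "29 * x / (1 - 29 / 536) \<le> 30.74 * x" if "0 \<le> x" for x :: real
      using that by simp
    ultimately show "0 \<le> ?gh" "?gh \<le> 30.74 * (p2 * m * u)"
      using \<open>0 \<le> p2 * m * u\<close> by (meson order_trans)+
  qed
  obtain E1 where E1: "W1 = S1 ** V + E1" "norm E1 \<le> ?gn * (norm S1 * norm V)"
    using fl_product_error [OF W1 gn(1)] .
  obtain E2 where E2: "W = S2 ** W1 + E2" "norm E2 \<le> ?gp * (norm S2 * norm W1)"
    using fl_product_error [OF W gp(1)] .
  obtain E where E: "\<And>x. norm (R *v x) = norm ((W + E) *v x)" "norm E \<le> ?gh * norm W"
    using fl_householder_error [OF R gh(1)] by blast
  have nV: "norm V \<le> L"
    unfolding L_def m by (intro norm_matrix_le_sqrt_columns V nonneg)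
  have nE1: "norm E1 \<le> ?gn * norm S1 * L"
    using E1(2) nV gn(1) by (smt (verit) mult.assoc mult_left_mono norm_ge_zero)
  have "norm (S1 ** V) \<le> c * norm V"
    by (rule norm_matrix_mult_le_bound) (use nonneg S1V in auto)
  also have "\<dots> \<le> c * L" using nV nonneg by (intro mult_left_mono)
  finally have nW1: "norm W1 \<le> (c + ?gn * norm S1) * L"
    using norm_triangle_ineq [of "S1 ** V" E1] nE1 by (simp add: E1(1) algebra_simps)
  have "norm S2 \<le> s * sqrt p2"
    unfolding s_def p2 by (rule norm_matrix_le_sqrt_rows)
  then have "norm S2 * norm W1 \<le> (s * sqrt p2) * ((c + ?gn * norm S1) * L)"
    using nW1 s p2 by (intro mult_mono) auto
  then have nE2: "norm E2 \<le> ?gp * ((s * sqrt p2) * ((c + ?gn * norm S1) * L))"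
    using E2(2) gp(1) by (smt (verit) mult_left_mono)
  define T where "T = S2 ** E1 + E2"
  define D2 where "D2 = s * L * u * (p1 * sqrt p2 * c + n * norm S1)"
  have D2: "0 \<le> D2" using s L nonneg p1 p2 n by (simp add: D2_def)
  have gps: "0 \<le> ?gp * sqrt p2" "?gp * sqrt p2 \<le> 107 / 100 * (p1 * sqrt p2 * u)"
    using gp mult_right_mono [OF gp(2), of "sqrt p2"] p2 by (simp_all add: mult_ac)
  have gps': "?gp * sqrt p2 \<le> 9 / 100" using gps(2) p12 by simp
  have gnS: "0 \<le> ?gn * norm S1" "?gn * norm S1 \<le> 21 / 20 * (n * norm S1 * u)"
    using gn mult_right_mono [OF gn(2), of "norm S1"] by (simp_all add: mult_ac)
  have "norm (S2 ** E1) \<le> s * norm E1"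
    unfolding s_def by (rule norm_matrix_mult_le_spectral)
  also have "\<dots> \<le> s * (?gn * norm S1 * L)" using nE1 s by (intro mult_left_mono)
  finally have "norm T \<le> s * L * (?gn * norm S1 + ?gp * sqrt p2 * c + (?gp * sqrt p2) * (?gn * norm S1))"
    using norm_triangle_ineq [of "S2 ** E1" E2] nE2 by (simp add: T_def algebra_simps)
  \<comment> \<open>The product of the two rounding errors is absorbed:
    \<open>21 / 20 * (1 + 9 / 100)\<close> and \<open>107 / 100\<close> both stay below
    \<open>23 / 20\<close>.\<close>
  also have "\<dots> \<le> s * L * (23 / 20 * (u * (p1 * sqrt p2 * c + n * norm S1)))"
  proof (rule mult_left_mono)
    have "?gp * sqrt p2 * c \<le> 107 / 100 * (p1 * sqrt p2 * u) * c"
      using gps nonneg by (intro mult_right_mono)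
    moreover have "(?gp * sqrt p2) * (?gn * norm S1) \<le> 9 / 100 * (?gn * norm S1)"
      using gps' gnS by (intro mult_right_mono)
    moreover have "0 \<le> p1 * sqrt p2 * u * c" "0 \<le> n * norm S1 * u"
      using nonneg p1 p2 n by simp_all
    moreover have "u * (p1 * sqrt p2 * c + n * norm S1) = p1 * sqrt p2 * u * c + n * norm S1 * u"
      by (simp add: algebra_simps)
    ultimately show "?gn * norm S1 + ?gp * sqrt p2 * c + (?gp * sqrt p2) * (?gn * norm S1)
        \<le> 23 / 20 * (u * (p1 * sqrt p2 * c + n * norm S1))"
      using gnS by linarith
  qed (use s L in simp)
  also have "\<dots> = 23 / 20 * D2" by (simp add: D2_def)
  finally have nT: "norm T \<le> 23 / 20 * D2" .
  define D1 where "D1 = b * p2 * m * u * L"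
  have D1: "0 \<le> D1" using L nonneg p2 m by (simp add: D1_def)
  have WT: "W = S2 ** (S1 ** V) + T"
    by (simp add: E2(1) E1(1) T_def matrix_add_ldistrib)
  have "norm (S2 ** (S1 ** V)) \<le> b * norm V"
    by (rule norm_matrix_mult_le_bound) (use nonneg S2V in \<open>auto simp flip: matrix_vector_mul_assoc\<close>)
  also have "\<dots> \<le> b * L" using nV nonneg by (intro mult_left_mono)
  finally have nW: "norm W \<le> b * L + 23 / 20 * D2"
    using norm_triangle_ineq [of "S2 ** (S1 ** V)" T] nT by (simp add: WT)
  have "norm E \<le> 30.74 * (p2 * m * u) * (b * L + 23 / 20 * D2)"
    using E(2) nW gh D2 L nonneg by (smt (verit) mult_mono norm_ge_zero)
  also have "\<dots> = 30.74 * D1 + 35.351 * (p2 * m * u) * D2"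
    by (simp add: D1_def algebra_simps)
  also have "\<dots> \<le> 30.74 * D1 + 35.351 * (1 / 536) * D2"
    using p2m D2 by (intro add_left_mono mult_right_mono mult_left_mono) auto
  \<comment> \<open>The coefficient of \<open>D1\<close> is \<open>30.74\<close>, that of
    \<open>D2\<close> less than \<open>1.3\<close>; both lie below \<open>383 / 12\<close>, so
    \<open>F\<close> is at most a twelfth of the quantity controlled by
    \<open>\<delta>\<close>.\<close>
  finally have "norm (T + E) \<le> 383 / 12 * (D1 + D2)"
    using norm_triangle_ineq [of T E] nT D1 D2 by simp
  moreover have "D1 + D2 = (b * p2 * (m * sqrt m)
      + sqrt m * spectral_norm S2 * (p1 * sqrt p2 * c + n * norm S1)) * u * N"
    by (simp add: D1_def D2_def L_def s_def algebra_simps)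
  moreover have "norm (R *v x) = norm ((S2 ** (S1 ** V) + (T + E)) *v x)" for x
    using E(1) [of x] by (simp add: WT add.assoc)
  ultimately show thesis using that by metis
qed

text \<open>Replaces the inverse of \<open>R\<close>: writing any \<open>x\<close> as
  \<open>R *v y\<close> allows statements about \<open>Q\<close> to be proved for
  \<open>Q *v (R *v y)\<close>, which is close to \<open>V *v y\<close>.\<close>

lemma surj_matrix_of_bounded_below:
  fixes R :: "real^'m^'m"
  assumes "0 < c" "\<And>x. c * norm x \<le> norm (R *v x)"
  obtains y where "x = R *v y"
proof -
  have "R *v y = 0 \<Longrightarrow> y = 0" for y
    using assms(2) [of y] assms(1) by (simp add: mult_le_0_iff)
  then have "inj ((*v) R)"
    by (metis matrix_left_invertible_injective matrix_left_invertible_ker)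
  then have "surj ((*v) R)" by (simp add: linear_injective_imp_surjective)
  then show thesis using that by (metis surjD)
qed

text \<open>For \<open>x = R *v y\<close>, \<open>Q *v x\<close> is \<open>V *v y\<close> minus the
  residual at \<open>y\<close>. The hypotheses compare \<open>V *v y\<close> with \<open>x\<close>
  from both sides, and the residual is a small multiple of the spectral norm of \<open>Q\<close>
  times \<open>norm x\<close>.\<close>

lemma preconditioned_bounds:
  fixes V Q :: "real^'m^'n" and R :: "real^'m^'m"
  assumes R_lower: "\<And>x. 11 / 12 * a * norm (V *v x) \<le> norm (R *v x)"
    and R_upper: "\<And>x. norm (R *v x) \<le> 13 / 12 * b * norm (V *v x)"
    and V_lower: "\<And>x. \<sigma> * norm x \<le> norm (V *v x)" and V_upper: "\<And>x. norm (V *v x) \<le> N * norm x"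
    and pos: "0 < a" "0 < b" "0 < \<sigma>" "0 \<le> N" "0 \<le> \<gamma>" and ab: "3 * b < 25 * a"
    and res: "norm (V - Q ** R) \<le> \<gamma> * (norm Q * norm R)"
    and small: "\<gamma> * real CARD('m) * b * N \<le> a * \<sigma> / 530"
  shows "norm (Q *v x) \<le> 1.1 / a * norm x" and "0.9 / b * norm x \<le> norm (Q *v x)"
proof -
  define q where "q = spectral_norm Q"
  have q: "0 \<le> q" by (simp add: q_def spectral_norm_nonneg)
  have R_bound: "norm (R *v x) \<le> 13 / 12 * b * N * norm x" for x
  proof -
    have "13 / 12 * b * norm (V *v x) \<le> 13 / 12 * b * (N * norm x)"
      using V_upper pos by (intro mult_left_mono) auto
    then show ?thesis using R_upper [of x] by (simp add: mult.assoc)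
  qed
  have "norm Q * norm R \<le> q * (13 / 12 * b * N) * (sqrt (real CARD('m)) * sqrt (real CARD('m)))"
    by (intro norm_times_spectral_bounds R_bound) (use q pos in \<open>simp_all add: q_def norm_le_spectral_norm\<close>)
  then have "norm (V - Q ** R) \<le> \<gamma> * (q * (13 / 12 * b * N) * (sqrt (real CARD('m)) * sqrt (real CARD('m))))"
    using res pos(5) by (meson mult_left_mono order_trans)
  also have "\<dots> = 13 / 12 * q * (\<gamma> * real CARD('m) * b * N)" by simp
  also have "\<dots> \<le> 13 / 12 * q * (a * \<sigma> / 530)"
    using small q by (intro mult_left_mono) auto
  finally have D: "norm (V - Q ** R) \<le> 13 / 6360 * q * a * \<sigma>" by simp
  \<comment> \<open>\<open>13 / 6360\<close> is \<open>13 / 12 / 530\<close>; passing from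
    \<open>V *v y\<close> to \<open>R *v y\<close> costs \<open>12 / 11\<close>, and
    \<open>13 / 5830 < 1 / 448\<close>.\<close>
  have Dy: "norm ((V - Q ** R) *v y) \<le> q / 448 * norm (R *v y)" for y
  proof -
    have "norm ((V - Q ** R) *v y) \<le> 13 / 6360 * q * a * \<sigma> * norm y"
      using norm_matrix_vector_le [of "V - Q ** R" y] D by (smt (verit) mult_right_mono norm_ge_zero)
    also have "\<dots> = 13 / 6360 * q * a * (\<sigma> * norm y)" by simp
    also have "\<dots> \<le> 13 / 6360 * q * a * norm (V *v y)"
      using V_lower q pos by (intro mult_left_mono) auto
    also have "\<dots> = 13 / 5830 * q * (11 / 12 * a * norm (V *v y))" by simp
    also have "\<dots> \<le> 13 / 5830 * q * norm (R *v y)"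
      using R_lower q by (intro mult_left_mono) auto
    also have "\<dots> \<le> q / 448 * norm (R *v y)"
      using q by (intro mult_right_mono) auto
    finally show ?thesis .
  qed
  have QR: "Q *v (R *v y) = V *v y - (V - Q ** R) *v y" for y
    by (simp add: matrix_vector_mult_diff_rdistrib matrix_vector_mul_assoc)
  have "0 < 11 / 12 * a * \<sigma>" using pos by simp
  moreover have "11 / 12 * a * \<sigma> * norm x \<le> norm (R *v x)" for x
  proof -
    have "11 / 12 * a * (\<sigma> * norm x) \<le> 11 / 12 * a * norm (V *v x)"
      using V_lower pos by (intro mult_left_mono) auto
    with R_lower [of x] have "11 / 12 * a * (\<sigma> * norm x) \<le> norm (R *v x)" by linarith
    then show ?thesis by (simp only: mult.assoc)
  qed
  ultimately have surj: "\<exists>y. x = R *v y" for x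
    by (rule surj_matrix_of_bounded_below) blast
  have upper: "norm (Q *v x) \<le> (12 / 11 / a + q / 448) * norm x" for x
  proof -
    obtain y where y: "x = R *v y" using surj by blast
    have "norm (Q *v x) \<le> norm (V *v y) + norm ((V - Q ** R) *v y)"
      unfolding y QR by (rule norm_triangle_ineq4)
    also have "norm (V *v y) \<le> 12 / 11 / a * norm x"
      using R_lower [of y] pos by (simp add: y field_simps)
    also have "norm ((V - Q ** R) *v y) \<le> q / 448 * norm x"
      using Dy [of y] by (simp add: y)
    finally show ?thesis by (simp add: distrib_right)
  qed
  \<comment> \<open>Self-referential bound: \<open>q\<close> occurs on both sides, and its small
    coefficient on the right lets it be solved for.\<close>
  have "q \<le> 12 / 11 / a + q / 448"
    unfolding q_def by (rule onorm_le) (use upper in \<open>simp add: q_def\<close>)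
  then have q_le: "q \<le> 1.1 / a" using pos by (simp add: field_simps)
  show "norm (Q *v x) \<le> 1.1 / a * norm x"
    using norm_le_spectral_norm [of Q x] q_le unfolding q_def
    by (meson mult_right_mono norm_ge_zero order_trans)
  obtain y where y: "x = R *v y" using surj by blast
  have "norm (V *v y) - norm ((V - Q ** R) *v y) \<le> norm (Q *v x)"
    unfolding y QR by (rule norm_triangle_ineq2)
  moreover have "12 / 13 / b * norm x \<le> norm (V *v y)"
    using R_upper [of y] pos by (simp add: y field_simps)
  moreover have "norm ((V - Q ** R) *v y) \<le> q / 448 * norm x"
    using Dy [of y] by (simp add: y)
  \<comment> \<open>Here \<open>b / a < 25 / 3\<close> enters: it converts the residual, of order
    \<open>1 / a\<close>, into a small multiple of \<open>1 / b\<close>.\<close>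
  moreover have "0.9 / b + q / 448 \<le> 12 / 13 / b"
  proof -
    have "1.1 / a \<le> 1.1 * (25 / 3) / b" using ab pos by (simp add: field_simps)
    with q_le have "q / 448 \<le> 1.1 * (25 / 3) / b / 448" by simp
    moreover have "0.9 / b + 1.1 * (25 / 3) / b / 448 \<le> 12 / 13 / b"
      using pos by (simp add: field_simps)
    ultimately show ?thesis by linarith
  qed
  then have "(0.9 / b + q / 448) * norm x \<le> 12 / 13 / b * norm x"
    by (rule mult_right_mono) simp
  ultimately show "0.9 / b * norm x \<le> norm (Q *v x)"
    by (simp add: distrib_right)
qed

text \<open>Since \<open>E\<close> is small against the square of \<open>s\<close>,
  \<open>norm (R *v y)\<close> is at least \<open>\<theta> * norm (X *v y)\<close>, so
  \<open>R\<close> is invertible and \<open>X\<close> times its inverse has norm at most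
  \<open>1 / \<theta>\<close>. The solve adds a relative residual \<open>g * q\<close>. In the
  second bound the three summands come from the Cholesky error, the two cross terms with the
  residual, and the squared residual.\<close>

lemma cholesky_QR_perturbation:
  fixes X Q :: "real^'m^'n" and R E :: "real^'m^'m"
  assumes RR: "transpose R ** R = transpose X ** X + E" and E: "norm E \<le> \<eta> * s\<^sup>2"
    and X: "\<And>x. s * norm x \<le> norm (X *v x)"
    and res: "norm (X - Q ** R) \<le> \<gamma> * (norm Q * norm R)" and R: "norm R \<le> \<rho> * sqrt (real CARD('m))"
    and pos: "0 < s" "0 \<le> \<eta>" "\<eta> < 1" "0 \<le> \<gamma>" "0 \<le> \<rho>"
    and \<theta>: "\<theta> = sqrt (1 - \<eta>)" and g: "g = \<gamma> * real CARD('m) * \<rho> / (s * \<theta>)" and q: "q = spectral_norm Q"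
  shows "q * (1 - g) \<le> 1 / \<theta>"
    and "spectral_norm (transpose Q ** Q - mat 1) \<le> \<eta> / \<theta>\<^sup>2 + 2 * (g * q) / \<theta> + (g * q)\<^sup>2"
proof -
  have th: "0 < \<theta>" "\<theta>\<^sup>2 = 1 - \<eta>" using pos by (simp_all add: \<theta>)
  have q0: "0 \<le> q" by (simp add: q spectral_norm_nonneg)
  have g0: "0 \<le> g" using pos th by (simp add: g)
  let ?D = "X - Q ** R"
  have Ry: "(norm (R *v y))\<^sup>2 = (norm (X *v y))\<^sup>2 + (E *v y) \<bullet> y" for y
    using arg_cong [OF RR, of "\<lambda>A. (A *v y) \<bullet> y"]
    by (simp add: transpose_mult_inner matrix_vector_mult_add_rdistrib inner_add_left power2_norm_eq_inner)
  have Ey: "\<bar>(E *v y) \<bullet> z\<bar> \<le> \<eta> * s\<^sup>2 * norm y * norm z" for y z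
  proof -
    have "\<bar>(E *v y) \<bullet> z\<bar> \<le> norm (E *v y) * norm z" by (rule Cauchy_Schwarz_ineq2)
    also have "norm (E *v y) \<le> norm E * norm y" by (rule norm_matrix_vector_le)
    also have "norm E * norm y \<le> \<eta> * s\<^sup>2 * norm y" using E by (intro mult_right_mono) auto
    finally show ?thesis by (simp add: mult_right_mono)
  qed
  have XR: "\<theta> * norm (X *v y) \<le> norm (R *v y)" for y
  proof -
    have "s\<^sup>2 * (norm y)\<^sup>2 \<le> (norm (X *v y))\<^sup>2"
      using power_mono [OF X [of y], of 2] pos by (simp add: power_mult_distrib)
    then have "\<eta> * (s\<^sup>2 * (norm y)\<^sup>2) \<le> \<eta> * (norm (X *v y))\<^sup>2"
      using pos by (intro mult_left_mono)
    then have "(1 - \<eta>) * (norm (X *v y))\<^sup>2 \<le> (norm (R *v y))\<^sup>2"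
      using Ry [of y] Ey [of y y] by (simp add: algebra_simps power2_eq_square)
    then have "(\<theta> * norm (X *v y))\<^sup>2 \<le> (norm (R *v y))\<^sup>2"
      by (simp add: power_mult_distrib th)
    then show ?thesis by (rule power2_le_imp_le) simp
  qed
  have yR: "s * \<theta> * norm y \<le> norm (R *v y)" for y
  proof -
    have "\<theta> * (s * norm y) \<le> \<theta> * norm (X *v y)"
      using X th by (intro mult_left_mono) auto
    then show ?thesis using XR [of y] by (simp add: mult_ac)
  qed
  have surj: "\<exists>y. x = R *v y" for x
    using surj_matrix_of_bounded_below [OF mult_pos_pos [OF pos(1) th(1)] yR] by blast
  have Dy: "norm (?D *v y) \<le> g * q * norm (R *v y)" for y
  proof -
    have "norm Q \<le> q * sqrt (real CARD('m))"
      by (intro norm_matrix_le_sqrt_columns q0) (simp add: q norm_le_spectral_norm)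
    then have "norm Q * norm R \<le> (q * sqrt (real CARD('m))) * (\<rho> * sqrt (real CARD('m)))"
      using R q0 pos by (intro mult_mono) auto
    then have "norm ?D \<le> \<gamma> * ((q * sqrt (real CARD('m))) * (\<rho> * sqrt (real CARD('m))))"
      using res pos by (meson mult_left_mono order_trans)
    also have "\<dots> = \<gamma> * real CARD('m) * \<rho> * q" by simp
    \<comment> \<open>\<open>g\<close> is defined so that the residual is measured in units of
      \<open>s * \<theta>\<close>, the lower bound for \<open>R\<close>.\<close>
    also have "\<dots> = g * q * (s * \<theta>)" using pos th by (simp add: g)
    finally have "norm (?D *v y) \<le> g * q * (s * \<theta>) * norm y"
      using norm_matrix_vector_le [of ?D y] by (smt (verit) mult_right_mono norm_ge_zero)
    also have "\<dots> \<le> g * q * norm (R *v y)"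
      using yR [of y] q0 g0 by (simp add: mult_left_mono mult.assoc)
    finally show ?thesis .
  qed
  have QR: "Q *v (R *v y) = X *v y - ?D *v y" for y
    by (simp add: matrix_vector_mult_diff_rdistrib matrix_vector_mul_assoc)
  have Xy: "norm (X *v y) \<le> 1 / \<theta> * norm (R *v y)" for y
    using XR [of y] th by (simp add: field_simps)
  have "q \<le> 1 / \<theta> + g * q"
    unfolding q
  proof (rule onorm_le, fold q)
    fix x
    obtain y where y: "x = R *v y" using surj by blast
    have "norm (Q *v x) \<le> norm (X *v y) + norm (?D *v y)"
      unfolding y QR by (rule norm_triangle_ineq4)
    also have "\<dots> \<le> (1 / \<theta> + g * q) * norm x"
      using Xy [of y] Dy [of y] by (simp add: y distrib_right)
    finally show "norm (Q *v x) \<le> (1 / \<theta> + g * q) * norm x" .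
  qed
  then show "q * (1 - g) \<le> 1 / \<theta>" by (simp add: algebra_simps)
  show "spectral_norm (transpose Q ** Q - mat 1) \<le> \<eta> / \<theta>\<^sup>2 + 2 * (g * q) / \<theta> + (g * q)\<^sup>2"
  proof (rule spectral_norm_leI_bilinear)
    show "0 \<le> \<eta> / \<theta>\<^sup>2 + 2 * (g * q) / \<theta> + (g * q)\<^sup>2"
      using pos th q0 g0 by simp
    fix x x'
    obtain y where y: "x = R *v y" using surj by blast
    obtain y' where y': "x' = R *v y'" using surj by blast
    have "(E *v y) \<bullet> y' = x \<bullet> x' - (X *v y) \<bullet> (X *v y')"
      using arg_cong [OF RR, of "\<lambda>A. (A *v y) \<bullet> y'"]
      by (simp add: y y' transpose_mult_inner matrix_vector_mult_add_rdistrib inner_add_left)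
    \<comment> \<open>\<open>(E *v y) \<bullet> y'\<close> measures how far the exact quotient is
      from orthonormal; substituting \<open>QR\<close> adds the residual terms.\<close>
    then have eq: "((transpose Q ** Q - mat 1) *v x) \<bullet> x' =
        - ((E *v y) \<bullet> y') - (X *v y) \<bullet> (?D *v y') - (?D *v y) \<bullet> (X *v y') + (?D *v y) \<bullet> (?D *v y')"
      unfolding matrix_vector_mult_diff_rdistrib [of "transpose Q ** Q"] inner_diff_left transpose_mult_inner
        matrix_vector_mul_lid
      unfolding y y' QR inner_diff_left inner_diff_right by simp
    have CS: "\<bar>v \<bullet> w\<bar> \<le> (\<alpha> * norm x) * (\<beta> * norm x')"
      if "norm v \<le> \<alpha> * norm x" "norm w \<le> \<beta> * norm x'" for v w :: "real^'n" and \<alpha> \<beta>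
      using Cauchy_Schwarz_ineq2 [of v w] mult_mono [OF that] that
      by (smt (verit) norm_ge_zero)
    have "\<bar>(E *v y) \<bullet> y'\<bar> \<le> \<eta> / \<theta>\<^sup>2 * norm x * norm x'"
    proof -
      have "\<bar>(E *v y) \<bullet> y'\<bar> \<le> \<eta> / \<theta>\<^sup>2 * ((s * \<theta> * norm y) * (s * \<theta> * norm y'))"
        using Ey [of y y'] th(1) by (simp add: power2_eq_square mult_ac)
      also have "\<dots> \<le> \<eta> / \<theta>\<^sup>2 * (norm x * norm x')"
        unfolding y y' using yR pos th by (intro mult_left_mono mult_mono) auto
      finally show ?thesis by (simp add: mult.assoc)
    qed
    moreover have "\<bar>(X *v y) \<bullet> (?D *v y')\<bar> \<le> (1 / \<theta> * norm x) * (g * q * norm x')"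
      and "\<bar>(?D *v y) \<bullet> (X *v y')\<bar> \<le> (g * q * norm x) * (1 / \<theta> * norm x')"
      and "\<bar>(?D *v y) \<bullet> (?D *v y')\<bar> \<le> (g * q * norm x) * (g * q * norm x')"
      unfolding y y' by ((rule CS [unfolded y y']; rule Xy Dy)+)
    ultimately have "\<bar>((transpose Q ** Q - mat 1) *v x) \<bullet> x'\<bar> \<le> \<eta> / \<theta>\<^sup>2 * norm x * norm x'
        + (1 / \<theta> * norm x) * (g * q * norm x') + (g * q * norm x) * (1 / \<theta> * norm x')
        + (g * q * norm x) * (g * q * norm x')"
      unfolding eq by linarith
    also have "\<dots> = (\<eta> / \<theta>\<^sup>2 + 2 * (g * q) / \<theta> + (g * q)\<^sup>2) * norm x * norm x'"
      by (simp add: algebra_simps power2_eq_square)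
    finally show "\<bar>((transpose Q ** Q - mat 1) *v x) \<bullet> x'\<bar>
        \<le> (\<eta> / \<theta>\<^sup>2 + 2 * (g * q) / \<theta> + (g * q)\<^sup>2) * norm x * norm x'" .
  qed
qed

text \<open>
  \<open>x\<close> stands for \<open>(nm + m(m+1)) u\<close>, \<open>y\<close> for \<open>m\<^sup>2 u\<close> and \<open>\<tau>\<close> for \<open>sqrt ((1 + \<epsilon>H) / (1 - \<epsilon>L))\<close>.
  The smallness hypotheses come from \<open>\<delta> \<le> 1\<close>, with \<open>536 \<le> 383 * sqrt 2\<close>.
\<close>

lemma orthogonality_constants:
  fixes \<tau> x y :: real
  assumes \<tau>: "1 \<le> \<tau>" "\<tau> < 25 / 3" and y: "0 \<le> y" "2 * y \<le> x" "x \<le> 1 / 383 + 1.5 * y" "\<tau> * y \<le> 1 / 536"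
    and \<eta>: "\<eta> = 1.52 * \<tau>\<^sup>2 * x"
  shows "0 \<le> \<eta>" "\<eta> \<le> 0.312" "0.829 \<le> sqrt (1 - \<eta>)"
proof -
  show "0 \<le> \<eta>" using y by (simp add: \<eta>)
  have t2: "\<tau> * \<tau> \<le> (25 / 3) * (25 / 3)" using \<tau> by (intro mult_mono) auto
  have ty: "\<tau> * (\<tau> * y) \<le> (25 / 3) * (1 / 536)" using \<tau> y by (intro mult_mono) auto
  have "\<tau>\<^sup>2 * x \<le> \<tau>\<^sup>2 * (1 / 383 + 1.5 * y)"
    using y by (intro mult_left_mono) auto
  also have "\<dots> = \<tau> * \<tau> / 383 + 1.5 * (\<tau> * (\<tau> * y))"
    by (simp add: power2_eq_square algebra_simps)
  also have "\<dots> \<le> (25 / 3) * (25 / 3) / 383 + 1.5 * ((25 / 3) * (1 / 536))"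
    using t2 ty by (intro add_mono divide_right_mono mult_left_mono) auto
  finally show \<eta>312: "\<eta> \<le> 0.312" by (simp add: \<eta> mult_ac)
  \<comment> \<open>\<open>0.829\<close> squared is \<open>0.687241\<close>, just below
    \<open>1 - 0.312\<close>.\<close>
  then show "0.829 \<le> sqrt (1 - \<eta>)"
    by (intro real_le_rsqrt) (simp add: power2_eq_square)
qed

text \<open>All three error terms reduce to multiples of the square of \<open>\<tau>\<close> times
  \<open>x\<close>, because \<open>\<tau> \<ge> 1\<close> and \<open>2 * y \<le> x\<close> bound
  \<open>\<tau> * y\<close> by half of it. Their sum is compared with
  \<open>8.712 = 5445 / 625\<close>, the value of the target coefficient when the \<open>3\<close>
  in its denominator is dropped.\<close>

lemma orthogonality_numerics:
  fixes \<tau> x y q g :: real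
  assumes \<tau>: "1 \<le> \<tau>" "\<tau> < 25 / 3" and y: "0 \<le> y" "2 * y \<le> x" "x \<le> 1 / 383 + 1.5 * y" "\<tau> * y \<le> 1 / 536"
    and \<eta>: "\<eta> = 1.52 * \<tau>\<^sup>2 * x" and \<theta>: "\<theta> = sqrt (1 - \<eta>)"
    and g: "0 \<le> g" "g \<le> 1.2269 * (\<tau> * y) / \<theta>" and q: "0 \<le> q" "q * (1 - g) \<le> 1 / \<theta>"
  shows "q \<le> 1.21"
    and "\<eta> / \<theta>\<^sup>2 + 2 * (g * q) / \<theta> + (g * q)\<^sup>2 \<le> 5445 / (25 / \<tau> - 3)\<^sup>2 * x"
proof -
  note c = orthogonality_constants [OF \<tau> y \<eta>]
  have th: "0.829 \<le> \<theta>" "\<theta>\<^sup>2 = 1 - \<eta>" using c by (simp_all add: \<theta>)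
  have inv: "1 / \<theta> \<le> 1.2063" using th(1) by (simp add: field_simps)
  have ty0: "0 \<le> \<tau> * y" using \<tau> y by simp
  have "1.2269 * (\<tau> * y) / \<theta> = 1.2269 * (\<tau> * y) * (1 / \<theta>)" by simp
  also have "\<dots> \<le> 1.2269 * (\<tau> * y) * 1.2063"
    \<comment> \<open>\<open>1.2063\<close> rounds up \<open>1 / 0.829\<close>.\<close>
    using inv ty0 by (intro mult_left_mono) auto
  finally have g': "g \<le> 1.481 * (\<tau> * y)" using g(2) ty0 by simp
  then have "g \<le> 0.00277" using y by simp
  then have "q * (1 - 0.00277) \<le> q * (1 - g)" using q by (intro mult_left_mono) auto
  then show q': "q \<le> 1.21" using q(2) inv by simp
  have gq0: "0 \<le> g * q" using g q by simp
  have "g * q \<le> 1.481 * (\<tau> * y) * 1.21" using g' g q q' ty0 by (intro mult_mono) auto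
  then have gq: "g * q \<le> 1.793 * (\<tau> * y)" using ty0 by simp
  have t1: "\<tau> * y \<le> \<tau>\<^sup>2 * x / 2"
  proof -
    have "\<tau> * y \<le> \<tau>\<^sup>2 * (x / 2)"
      using \<tau> y by (intro mult_mono) (auto simp: power2_eq_square)
    then show ?thesis by simp
  qed
  have x0: "0 \<le> \<tau>\<^sup>2 * x" using y by simp
  have "\<eta> / \<theta>\<^sup>2 \<le> \<eta> / 0.688"
    using c th by (intro divide_left_mono) auto
  also have "\<eta> / 0.688 \<le> 2.2094 * (\<tau>\<^sup>2 * x)" using x0 by (simp add: \<eta> mult_ac)
  finally have A: "\<eta> / \<theta>\<^sup>2 \<le> 2.2094 * (\<tau>\<^sup>2 * x)" .
  have "2 * (g * q) / \<theta> = 2 * (g * q) * (1 / \<theta>)" by simp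
  also have "\<dots> \<le> 2 * (g * q) * 1.2063" using inv gq0 by (intro mult_left_mono) auto
  finally have B: "2 * (g * q) / \<theta> \<le> 2.4126 * (g * q)" by simp
  have "(g * q) * (g * q) \<le> (g * q) * 1"
    using gq gq0 y by (intro mult_left_mono) auto
  then have "\<eta> / \<theta>\<^sup>2 + 2 * (g * q) / \<theta> + (g * q)\<^sup>2 \<le> 8.7 * (\<tau>\<^sup>2 * x)"
    using A B gq t1 x0 by (simp add: power2_eq_square)
  also have "\<dots> \<le> 5445 / (25 / \<tau> - 3)\<^sup>2 * x"
  proof -
    have d: "0 < 25 / \<tau> - 3" "25 / \<tau> - 3 \<le> 25 / \<tau>" using \<tau> by (simp_all add: field_simps)
    then have "(25 / \<tau> - 3)\<^sup>2 \<le> (25 / \<tau>)\<^sup>2" by (intro power_mono) auto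
    then have "5445 / (25 / \<tau>)\<^sup>2 \<le> 5445 / (25 / \<tau> - 3)\<^sup>2"
      using d by (intro divide_left_mono mult_pos_pos) auto
    moreover have "5445 / (25 / \<tau>)\<^sup>2 = 8.712 * \<tau>\<^sup>2" by (simp add: power_divide)
    ultimately have "8.712 * \<tau>\<^sup>2 * x \<le> 5445 / (25 / \<tau> - 3)\<^sup>2 * x"
      using y by (intro mult_right_mono) auto
    then show ?thesis using x0 by simp
  qed
  finally show "\<eta> / \<theta>\<^sup>2 + 2 * (g * q) / \<theta> + (g * q)\<^sup>2 \<le> 5445 / (25 / \<tau> - 3)\<^sup>2 * x" .
qed

text \<open>The deterministic part. \<open>S1\<close> and \<open>S2\<close> enter through their
  action on the range of \<open>V\<close> and through the norms in \<open>\<delta>\<close>. That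
  hypothesis is multiplied by \<open>a * \<sigma>\<close>, so no quotient of singular values
  appears; \<open>N\<close> becomes \<open>sigma_max V\<close> in the application.\<close>

lemma rand_cholQR_bounds:
  fixes V Q :: "real^('m::{finite,linorder})^('n::finite)"
    and S1 :: "real^'n^('p1::finite)" and S2 :: "real^'p1^('p2::finite)"
  assumes fl: "fl_rand_cholQR u V S1 S2 Q R"
    and S1V: "\<And>x. norm (S1 *v (V *v x)) \<le> c * norm (V *v x)"
    and S2V_lower: "\<And>x. a * norm (V *v x) \<le> norm (S2 *v (S1 *v (V *v x)))"
    and S2V_upper: "\<And>x. norm (S2 *v (S1 *v (V *v x))) \<le> b * norm (V *v x)"
    and V_lower: "\<And>x. \<sigma> * norm x \<le> norm (V *v x)" and V_upper: "spectral_norm V \<le> N"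
    and ab: "0 < a" "a \<le> b" "3 * b < 25 * a" and c: "0 \<le> c" and \<sigma>: "0 < \<sigma>" and u: "0 < u"
    and n: "n = real CARD('n)" and m: "m = real CARD('m)"
    and p1: "p1 = real CARD('p1)" and p2: "p2 = real CARD('p2)"
    and dims: "2 \<le> m" "m \<le> p2" "m \<le> n"
    and p12: "p1 * sqrt p2 * u \<le> 1 / 12"
    and \<delta>: "383 * ((b * p2 * (m * sqrt m)
        + sqrt m * spectral_norm S2 * (p1 * sqrt p2 * c + n * norm S1)) * u * N) = a * \<sigma> * \<delta>" "\<delta> \<le> 1"
    and B: "B = 5445 / (25 * (a / b) - 3)\<^sup>2 * (n * m + m * (m + 1)) * u"
  shows "spectral_norm (transpose Q ** Q - mat 1) \<le> B"
    and "spectral_norm (V - Q ** R) \<le> (56 / (25 * (a / b) - 3) + 1.5 * sqrt (1 + B)) / a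
      * (b * spectral_norm V + a / 12 * \<sigma> * \<delta>) * m\<^sup>2 * u"
proof -
  obtain Q0 R0 R1 W1 W G where W1: "fl_product u S1 V W1" and W: "fl_product u S2 W1 W"
    and R0: "fl_householder u W R0" and Q0: "fl_row_solve u V R0 Q0"
    and G: "fl_product u (transpose Q0) Q0 G" and R1: "fl_cholesky u G R1"
    and Q: "fl_row_solve u Q0 R1 Q" and R: "fl_product u R1 R0 R"
    using fl unfolding fl_rand_cholQR_def fl_randQR_def fl_cholQR_def by blast
  define s where "s = spectral_norm S2"
  define f where "f = norm S1"
  define \<tau> where "\<tau> = b / a"
  define y where "y = m\<^sup>2 * u"
  define x where "x = (n * m + m * (m + 1)) * u"
  have b: "0 < b" using ab by simp
  have s: "0 \<le> s" by (simp add: s_def spectral_norm_nonneg)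
  have f: "0 \<le> f" by (simp add: f_def)
  have p1': "0 \<le> p1" using p1 by simp
  have V_N: "norm (V *v z) \<le> N * norm z" for z
    using norm_le_spectral_norm [of V z] V_upper by (meson mult_right_mono norm_ge_zero order_trans)
  \<comment> \<open>\<open>axis undefined 1\<close> is an arbitrary unit vector.\<close>
  have \<sigma>N: "\<sigma> \<le> N"
    using V_lower [of "axis undefined 1"] V_N [of "axis undefined 1"] by (simp add: norm_axis_1)
  then have N: "0 < N" using \<sigma> by simp
  have \<tau>: "1 \<le> \<tau>" "\<tau> < 25 / 3" using ab by (simp_all add: \<tau>_def field_simps)

  \<comment> \<open>Smallness of dimension times roundoff, from
    \<open>\<delta> \<le> 1\<close>\<close>
  have total: "383 * (b * p2 * (m * sqrt m) * u * N) + 383 * (sqrt m * s * (p1 * sqrt p2 * c) * u * N)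
      + 383 * (sqrt m * s * (n * f) * u * N) \<le> a * \<sigma>"
    using \<delta> mult_left_mono [OF \<delta>(2), of "a * \<sigma>"] ab \<sigma>
    by (simp add: s_def f_def algebra_simps)
  have parts: "0 \<le> b * p2 * (m * sqrt m) * u * N" "0 \<le> sqrt m * s * (p1 * sqrt p2 * c) * u * N"
    "0 \<le> sqrt m * s * (n * f) * u * N"
    using b s f c u N dims p1' by simp_all
  have \<delta>0: "0 \<le> \<delta>"
  proof -
    have "0 \<le> a * \<sigma> * \<delta>"
      unfolding \<delta>(1) [symmetric] s_def [symmetric] f_def [symmetric]
      using b s f c u N dims p1' by simp
    then show ?thesis using mult_pos_pos [OF ab(1) \<sigma>] by (smt (verit) mult_pos_neg)
  qed

  have "1.4 \<le> sqrt m" using dims by (intro real_le_rsqrt) (simp add: power2_eq_square)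
  then have "b * p2 * (m * 1.4) * u * N \<le> b * p2 * (m * sqrt m) * u * N"
    using b u N dims by (intro mult_right_mono mult_left_mono) auto
  then have p2m_N: "b * (p2 * m * u) * N \<le> a * \<sigma> / 536"
    using total parts by simp
  \<comment> \<open>Since \<open>a \<le> b\<close> and \<open>\<sigma> \<le> N\<close>, the factor
    \<open>b * N\<close> cancels, leaving a bound free of the condition number.\<close>
  have "a * \<sigma> \<le> b * N" using mult_mono [OF ab(2) \<sigma>N] b \<sigma> by simp
  then have "b * (p2 * m * u) * N \<le> b * N / 536" using p2m_N by linarith
  then have "(p2 * m * u) * (b * N) \<le> (1 / 536) * (b * N)" by (simp only: mult_ac times_divide_eq_left mult_1)
  then have p2m: "p2 * m * u \<le> 1 / 536" by (rule mult_right_le_imp_le) (use b N in simp)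
  have "m * m * u \<le> p2 * m * u"
    using dims u by (intro mult_right_mono) auto
  then have y_p2: "y \<le> p2 * m * u" by (simp add: y_def power2_eq_square)
  have y0: "0 \<le> y" using u by (simp add: y_def)
  have byN: "b * y * N \<le> a * \<sigma> / 536"
  proof -
    have "b * y * N \<le> b * (p2 * m * u) * N"
      using y_p2 b N by (intro mult_right_mono mult_left_mono) auto
    then show ?thesis using p2m_N by linarith
  qed
  have \<tau>y: "\<tau> * y \<le> 1 / 536"
  proof -
    have "a * \<sigma> / 536 \<le> a * N / 536" using \<sigma>N ab by simp
    then have "(b * y) * N \<le> (a / 536) * N" using byN by simp
    then have "b * y \<le> a / 536" using N by simp
    then show ?thesis using ab by (simp add: \<tau>_def field_simps)
  qed

  \<comment> \<open>An embedding cannot have a small norm, so \<open>\<delta> \<le> 1\<close> forces \<open>n m u\<close> to be small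
      independently of \<open>\<kappa>(V)\<close>; this makes the Cholesky step stable without further hypotheses.\<close>
  have nmu: "n * m * u \<le> 1 / 383"
  proof -
    have "a * \<sigma> * norm z \<le> norm ((S2 ** (S1 ** V)) *v z)" for z
    proof -
      have "a * (\<sigma> * norm z) \<le> a * norm (V *v z)" using V_lower ab by (intro mult_left_mono) auto
      also have "\<dots> \<le> norm ((S2 ** (S1 ** V)) *v z)"
        using S2V_lower by (simp flip: matrix_vector_mul_assoc)
      finally show ?thesis by (simp only: mult.assoc)
    qed
    \<comment> \<open>The lower bound in all \<open>m\<close> directions gains \<open>sqrt m\<close>
      in the Frobenius norm; with the \<open>sqrt m\<close> of the third summand this produces the
      full factor \<open>m\<close>.\<close>
    then have "a * \<sigma> * sqrt m \<le> norm (S2 ** (S1 ** V))"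
      unfolding m using ab \<sigma> by (intro norm_matrix_ge_sqrt_columns) auto
    also have "\<dots> \<le> s * norm (S1 ** V)"
      unfolding s_def by (rule norm_matrix_mult_le_spectral)
    also have "\<dots> \<le> s * (f * N)"
      unfolding f_def using s V_N N by (intro mult_left_mono norm_matrix_mult_le_spectral_right) auto
    finally have "(a * \<sigma> * sqrt m) * (sqrt m * n * u) \<le> s * (f * N) * (sqrt m * n * u)"
      using u dims by (intro mult_right_mono) auto
    also have "s * (f * N) * (sqrt m * n * u) = sqrt m * s * (n * f) * u * N" by simp
    also have "\<dots> \<le> a * \<sigma> / 383" using total parts by simp
    finally have "(a * \<sigma>) * (n * m * u) \<le> (a * \<sigma>) * (1 / 383)"
      using dims by (simp add: mult_ac)
    then show ?thesis using ab \<sigma> by simp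
  qed

  have n_u: "n * u \<le> 1 / 766"
  proof -
    have "n * 2 * u \<le> n * m * u" using dims u by (intro mult_right_mono mult_left_mono) auto
    then show ?thesis using nmu by simp
  qed
  have m_u: "m * u \<le> 1 / 1072"
  proof -
    have "m * 2 * u \<le> p2 * m * u" using dims u by (simp add: mult_right_mono mult.commute)
    then show ?thesis using p2m by simp
  qed
  have m1_u: "(m + 1) * u \<le> 1 / 714"
  proof -
    have "(m + 1) * u \<le> (3 / 2 * m) * u" using dims u by (intro mult_right_mono) auto
    then show ?thesis using m_u by simp
  qed
  \<comment> \<open>All three multiples of \<open>u\<close> are at most \<open>1 / 714\<close>, so
    \<open>501 / 500\<close> covers the denominators.\<close>
  let ?gn = "gam u CARD('n)" and ?gm = "gam u CARD('m)" and ?gh = "gam u (CARD('m) + 1)"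
  have gn: "0 \<le> ?gn" "?gn \<le> 501 / 500 * (n * u)"
    using gam_bounds [of u "CARD('n)" "1/766"] u n n_u by auto
  have gm: "0 \<le> ?gm" "?gm \<le> 501 / 500 * (m * u)"
    using gam_bounds [of u "CARD('m)" "1/1072"] u m m_u by auto
  have gh: "0 \<le> ?gh" "?gh \<le> 501 / 500 * ((m + 1) * u)"
  proof -
    have k: "real (CARD('m) + 1) * u = (m + 1) * u" by (simp add: m)
    moreover have "0 \<le> (m + 1) * u" using u dims by simp
    ultimately have "0 \<le> ?gh" "?gh \<le> (m + 1) * u / (1 - 1 / 714)"
      using gam_bounds [of u "CARD('m) + 1" "1/714"] u m1_u unfolding k by simp_all
    moreover have "z / (1 - 1 / 714) \<le> 501 / 500 * z" if "0 \<le> z" for z :: real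
      using that by simp
    ultimately show "0 \<le> ?gh" "?gh \<le> 501 / 500 * ((m + 1) * u)"
      using \<open>0 \<le> (m + 1) * u\<close> by (meson order_trans)+
  qed
  have gn': "?gn \<le> 0.00131" and gh': "?gh \<le> 0.001405"
    using gn(2) n_u gh(2) m1_u by simp_all

  \<comment> \<open>The sketched factor and the preconditioned basis\<close>
  obtain F where F: "\<And>z. norm (R0 *v z) = norm ((S2 ** (S1 ** V) + F) *v z)"
    and "norm F \<le> 383 / 12 * ((b * p2 * (m * sqrt m)
        + sqrt m * spectral_norm S2 * (p1 * sqrt p2 * c + n * norm S1)) * u * N)"
  proof (rule fl_sketch_QR [OF W1 W R0 V_N S1V S2V_upper _ c _ u n _ m p1 p2 _ p12 p2m])
    show "n * u \<le> 1 / 24" using n_u by simp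
  qed (use N b dims in simp_all)
  then have nF: "norm F \<le> a * \<sigma> * \<delta> / 12" using \<delta>(1) by simp
  have Fz: "norm (F *v z) \<le> a * \<sigma> * \<delta> / 12 * norm z" for z
    using norm_matrix_vector_le [of F z] nF by (meson mult_right_mono norm_ge_zero order_trans)
  \<comment> \<open>\<open>\<delta> \<le> 1\<close> and
    \<open>\<sigma> * norm z \<le> norm (V *v z)\<close> make \<open>F\<close> a relative
    perturbation of size \<open>a / 12\<close>; hence the factors \<open>11 / 12\<close> and
    \<open>13 / 12\<close> below.\<close>
  have FV: "norm (F *v z) \<le> a / 12 * norm (V *v z)" for z
  proof -
    have "a * \<sigma> * \<delta> / 12 * norm z \<le> a * \<sigma> * 1 / 12 * norm z"
      using \<delta> ab \<sigma> by (intro mult_right_mono divide_right_mono mult_left_mono) auto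
    also have "\<dots> = a / 12 * (\<sigma> * norm z)" by simp
    also have "\<dots> \<le> a / 12 * norm (V *v z)" using V_lower ab by (intro mult_left_mono) auto
    finally show ?thesis using Fz [of z] by linarith
  qed
  have R0z: "(S2 ** (S1 ** V) + F) *v z = S2 *v (S1 *v (V *v z)) + F *v z" for z
    by (simp add: matrix_vector_mult_add_rdistrib matrix_vector_mul_assoc)
  have R0_lower: "11 / 12 * a * norm (V *v z) \<le> norm (R0 *v z)" for z
    using norm_diff_ineq [of "S2 *v (S1 *v (V *v z))" "F *v z"] FV [of z] S2V_lower [of z]
    unfolding F R0z by linarith
  have R0_up: "norm (R0 *v z) \<le> b * norm (V *v z) + norm (F *v z)" for z
    using norm_triangle_ineq [of "S2 *v (S1 *v (V *v z))" "F *v z"] S2V_upper [of z]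
    unfolding F R0z by linarith
  have R0_upper: "norm (R0 *v z) \<le> 13 / 12 * b * norm (V *v z)" for z
  proof -
    have "a * norm (V *v z) \<le> b * norm (V *v z)" using ab by (intro mult_right_mono) auto
    then show ?thesis using R0_up [of z] FV [of z] by linarith
  qed
  \<comment> \<open>A second upper bound for \<open>R0\<close>, keeping \<open>\<delta>\<close>
    itself; it is the factor appearing in the final estimate.\<close>
  define r where "r = b * spectral_norm V + a / 12 * \<sigma> * \<delta>"
  have r0: "0 \<le> r" using b ab \<sigma> \<delta>0 by (simp add: r_def spectral_norm_nonneg)
  have R0_r: "norm (R0 *v z) \<le> r * norm z" for z
  proof -
    have "b * norm (V *v z) \<le> b * (spectral_norm V * norm z)"
      using norm_le_spectral_norm b by (intro mult_left_mono) auto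
    then show ?thesis
      using R0_up [of z] Fz [of z] by (simp add: r_def algebra_simps)
  qed
  have nR0: "norm R0 \<le> r * sqrt m" unfolding m by (intro norm_matrix_le_sqrt_columns r0 R0_r)

  have res0: "norm (V - Q0 ** R0) \<le> ?gm * (norm Q0 * norm R0)"
    by (rule fl_row_solve_error [OF Q0 gm(1)])
  have "?gm * real CARD('m) * b * N \<le> a * \<sigma> / 530"
  proof -
    have "?gm * (m * b * N) \<le> 501 / 500 * (m * u) * (m * b * N)"
      using gm(2) b N dims by (intro mult_right_mono) auto
    also have "\<dots> = 501 / 500 * (b * y * N)" by (simp add: y_def power2_eq_square)
    also have "\<dots> \<le> a * \<sigma> / 530" using byN mult_pos_pos [OF ab(1) \<sigma>] by linarith
    finally show ?thesis by (simp add: m mult.assoc)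
  qed
  note Q0b = preconditioned_bounds [OF R0_lower R0_upper V_lower V_N ab(1) b \<sigma> less_imp_le [OF N]
      gm(1) ab(3) res0 this]
  have nQ0: "norm Q0 \<le> 1.1 / a * sqrt m"
    unfolding m using ab by (intro norm_matrix_le_sqrt_columns Q0b(1)) auto
  have nQ0_sq: "(norm Q0)\<^sup>2 \<le> 1.21 / a\<^sup>2 * m"
    using power_mono [OF nQ0, of 2] dims by (simp add: power_mult_distrib power_divide power2_eq_square)

  \<comment> \<open>The Cholesky step and orthogonality\<close>
  have gh1: "?gh < 1" using gh' by simp
  obtain E where E: "transpose R1 ** R1 = transpose Q0 ** Q0 + E"
    "(norm R1)\<^sup>2 \<le> (1 + ?gn) / (1 - ?gh) * (norm Q0)\<^sup>2"
    "norm E \<le> ?gn * (norm Q0)\<^sup>2 + ?gh * (norm R1)\<^sup>2"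
    using fl_cholesky_error [OF G R1 gn(1) gh(1) gh1] .
  have "(1 + ?gn) / (1 - ?gh) \<le> 1.00131 / (1 - 0.001405)"
    using gn' gh' gn by (intro frac_le) auto
  also have "\<dots> \<le> 1.003" by simp
  finally have "(1 + ?gn) / (1 - ?gh) \<le> 1.003" .
  then have "(1 + ?gn) / (1 - ?gh) * (norm Q0)\<^sup>2 \<le> 1.003 * (1.21 / a\<^sup>2 * m)"
    using nQ0_sq dims by (intro mult_mono) auto
  with E(2) have R1_sq: "(norm R1)\<^sup>2 \<le> 1.003 * (1.21 / a\<^sup>2 * m)" by linarith
  also have "\<dots> = 1.21363 * (m / a\<^sup>2)" by simp
  \<comment> \<open>\<open>1.214404\<close> is the square of \<open>1.102\<close>.\<close>
  also have "\<dots> \<le> 1.214404 * (m / a\<^sup>2)" using dims by (intro mult_right_mono) auto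
  also have "\<dots> = (1.102 / a * sqrt m)\<^sup>2"
    using dims by (simp add: power_mult_distrib power_divide)
  finally have nR1: "norm R1 \<le> 1.102 / a * sqrt m"
    by (rule power2_le_imp_le) (use ab dims in simp)

  \<comment> \<open>\<open>1.52\<close> is \<open>1.2312 / 0.81\<close>, so that
    \<open>\<eta>\<close> times the square of \<open>0.9 / b\<close> equals
    \<open>1.2312 * x\<close> over the square of \<open>a\<close>, a bound for
    \<open>norm E\<close>.\<close>
  define \<eta> where "\<eta> = 1.52 * \<tau>\<^sup>2 * x"
  define \<theta> where "\<theta> = sqrt (1 - \<eta>)"
  define q where "q = spectral_norm Q"
  define g where "g = ?gm * real CARD('m) * (1.102 / a) / (0.9 / b * \<theta>)"
  have x_y: "2 * y \<le> x" "x \<le> 1 / 383 + 1.5 * y"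
  proof -
    have "m * m * u \<le> n * m * u" "m * 2 * u \<le> m * m * u"
      using dims u by (auto intro!: mult_right_mono mult_left_mono)
    moreover have "x = n * m * u + m * m * u + m * u" "y = m * m * u" "0 \<le> m * u"
      using u dims by (simp_all add: x_def y_def power2_eq_square algebra_simps)
    ultimately show "2 * y \<le> x" "x \<le> 1 / 383 + 1.5 * y" using nmu by simp_all
  qed
  note oc = orthogonality_constants [OF \<tau> y0 x_y \<tau>y \<eta>_def, folded \<theta>_def]
  have nE: "norm E \<le> \<eta> * (0.9 / b)\<^sup>2"
  proof -
    have "norm E \<le> 501 / 500 * (n * u) * (1.21 / a\<^sup>2 * m)
        + 501 / 500 * ((m + 1) * u) * (1.003 * (1.21 / a\<^sup>2 * m))"
      using E(3) mult_mono [OF gn(2) nQ0_sq] mult_mono [OF gh(2) R1_sq] u dims n by simp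
    also have "\<dots> = 1.21242 * (n * m * u / a\<^sup>2) + 1.21605726 * (m * (m + 1) * u / a\<^sup>2)"
      by (simp add: mult_ac)
    also have "\<dots> \<le> 1.2312 * (n * m * u / a\<^sup>2) + 1.2312 * (m * (m + 1) * u / a\<^sup>2)"
      using u dims by (intro add_mono mult_right_mono) auto
    also have "\<dots> = 1.2312 * x / a\<^sup>2"
      by (simp add: x_def distrib_right add_divide_distrib)
    also have "\<dots> = \<eta> * (0.9 / b)\<^sup>2"
      using b by (simp add: \<eta>_def \<tau>_def power_divide)
    finally show ?thesis .
  qed
  have resQ: "norm (Q0 - Q ** R1) \<le> ?gm * (norm Q * norm R1)"
    by (rule fl_row_solve_error [OF Q gm(1)])
  have pert: "q * (1 - g) \<le> 1 / \<theta>"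
    "spectral_norm (transpose Q ** Q - mat 1) \<le> \<eta> / \<theta>\<^sup>2 + 2 * (g * q) / \<theta> + (g * q)\<^sup>2"
    using cholesky_QR_perturbation [OF E(1) nE Q0b(2) resQ nR1 [unfolded m] _ oc(1) _ gm(1) _ \<theta>_def g_def q_def]
      oc(2) ab b by simp_all
  have \<theta>0: "0 < \<theta>" using oc(3) by simp
  have q0: "0 \<le> q" by (simp add: q_def spectral_norm_nonneg)
  have g0: "0 \<le> g" using gm ab b \<theta>0 by (simp add: g_def)
  have g_le: "g \<le> 1.2269 * (\<tau> * y) / \<theta>"
  proof -
    have "?gm * m \<le> 501 / 500 * (m * u) * m" using gm(2) dims by (intro mult_right_mono) auto
    then have gmm: "?gm * m \<le> 501 / 500 * y" by (simp add: y_def power2_eq_square mult_ac)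
    have "g = ?gm * m * (1.102 / 0.9 * \<tau> / \<theta>)"
      using ab b \<theta>0 by (simp add: g_def \<tau>_def m field_simps)
    also have "\<dots> \<le> (501 / 500 * y) * (1.102 / 0.9 * \<tau> / \<theta>)"
      using gmm \<tau> \<theta>0 by (intro mult_right_mono) auto
    also have "\<dots> = (501 / 500 * (1.102 / 0.9)) * (\<tau> * y) / \<theta>" by simp
    also have "\<dots> \<le> 1.2269 * (\<tau> * y) / \<theta>"
      using \<tau> y0 \<theta>0 by (intro divide_right_mono mult_right_mono) auto
    finally show ?thesis .
  qed
  note on = orthogonality_numerics [OF \<tau> y0 x_y \<tau>y \<eta>_def \<theta>_def g0 g_le q0 pert(1)]
  have "25 / \<tau> = 25 * (a / b)" by (simp add: \<tau>_def)
  then have B_x: "B = 5445 / (25 / \<tau> - 3)\<^sup>2 * x" by (simp add: B x_def)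
  show orth: "spectral_norm (transpose Q ** Q - mat 1) \<le> B"
    using pert(2) on(2) unfolding B_x by linarith

  \<comment> \<open>The factorization error\<close>
  have B0: "0 \<le> B"
    using orth spectral_norm_nonneg order_trans by blast
  have "q \<le> sqrt (1 + B)"
    unfolding q_def
  proof (rule onorm_le)
    fix z
    let ?O = "transpose Q ** Q - mat 1"
    have "(norm (Q *v z))\<^sup>2 = (norm z)\<^sup>2 + (?O *v z) \<bullet> z"
      by (simp add: matrix_vector_mult_diff_rdistrib inner_diff_left transpose_mult_inner power2_norm_eq_inner)
    also have "(?O *v z) \<bullet> z \<le> norm (?O *v z) * norm z" by (rule norm_cauchy_schwarz)
    also have "norm (?O *v z) \<le> B * norm z"
      using norm_le_spectral_norm [of ?O z] orth by (meson mult_right_mono norm_ge_zero order_trans)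
    finally have "(norm (Q *v z))\<^sup>2 \<le> (sqrt (1 + B) * norm z)\<^sup>2"
      using B0 by (simp add: power_mult_distrib mult_right_mono power2_eq_square algebra_simps)
    then show "norm (Q *v z) \<le> sqrt (1 + B) * norm z"
      by (rule power2_le_imp_le) (use B0 in simp)
  qed
  \<comment> \<open>\<open>a \<le> b\<close> gives \<open>h \<le> 22\<close>. Of
    \<open>2.2085 * q\<close>, the part \<open>1.5 * q\<close> is covered by
    \<open>1.5 * sqrt (1 + B)\<close>; the rest, with \<open>q \<le> 1.21\<close>, and
    \<open>1.1033\<close> fit below \<open>56 / 22\<close>.\<close>
  define h where "h = 25 * (a / b) - 3"
  have "0 < h" "h \<le> 22" using ab b by (simp_all add: h_def field_simps)
  then have "56 / 22 \<le> 56 / h" by (intro divide_left_mono) auto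
  with on(1) \<open>q \<le> sqrt (1 + B)\<close> have coeff: "1.1033 + 2.2085 * q \<le> 56 / h + 1.5 * sqrt (1 + B)"
    by simp

  obtain E3 where E3: "R = R1 ** R0 + E3" "norm E3 \<le> ?gm * (norm R1 * norm R0)"
    using fl_product_error [OF R gm(1)] .
  have nQ: "norm Q \<le> q * sqrt m"
    unfolding m by (intro norm_matrix_le_sqrt_columns q0) (simp add: q_def norm_le_spectral_norm)
  have split: "V - Q ** R = (V - Q0 ** R0) + ((Q0 - Q ** R1) ** R0 - Q ** E3)"
  proof -
    have "(Q0 - Q ** R1) ** R0 = Q0 ** R0 - Q ** (R1 ** R0)"
      by (simp add: matrix_eq matrix_vector_mult_diff_rdistrib flip: matrix_vector_mul_assoc)
    then show ?thesis by (simp add: E3(1) matrix_add_ldistrib)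
  qed
  have t1: "norm (V - Q0 ** R0) \<le> ?gm * m * (1.1 / a) * r"
  proof -
    have "norm Q0 * norm R0 \<le> (1.1 / a * sqrt m) * (r * sqrt m)"
      using nQ0 nR0 ab dims by (intro mult_mono) auto
    also have "\<dots> = m * (1.1 / a) * r" using dims by simp
    finally show ?thesis using res0 gm(1) by (smt (verit) mult.assoc mult_left_mono)
  qed
  have t2: "norm ((Q0 - Q ** R1) ** R0) \<le> ?gm * m * (1.102 / a) * q * r"
  proof -
    have "norm Q * norm R1 \<le> (q * sqrt m) * (1.102 / a * sqrt m)"
      using nQ nR1 q0 dims by (intro mult_mono) auto
    also have "\<dots> = m * (1.102 / a) * q" using dims by simp
    finally have "norm (Q0 - Q ** R1) \<le> ?gm * m * (1.102 / a) * q"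
      using resQ gm(1) by (smt (verit) mult.assoc mult_left_mono)
    moreover have "norm ((Q0 - Q ** R1) ** R0) \<le> norm (Q0 - Q ** R1) * r"
      by (intro norm_matrix_mult_le_spectral_right r0 R0_r)
    ultimately show ?thesis using r0 by (meson mult_right_mono order_trans)
  qed
  have t3: "norm (Q ** E3) \<le> ?gm * m * (1.102 / a) * q * r"
  proof -
    have "norm R1 * norm R0 \<le> (1.102 / a * sqrt m) * (r * sqrt m)"
      using nR0 nR1 ab dims by (intro mult_mono) auto
    also have "\<dots> = m * (1.102 / a) * r" using dims by simp
    finally have "norm E3 \<le> ?gm * (m * (1.102 / a) * r)"
      using E3(2) gm(1) by (meson mult_left_mono order_trans)
    then have "q * norm E3 \<le> q * (?gm * (m * (1.102 / a) * r))" using q0 by (rule mult_left_mono)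
    then show ?thesis
      using norm_matrix_mult_le_spectral [of Q E3] unfolding q_def by (simp add: mult_ac)
  qed
  have "spectral_norm (V - Q ** R) \<le> norm (V - Q ** R)" by (rule spectral_norm_le_norm)
  also have "\<dots> \<le> norm (V - Q0 ** R0) + (norm ((Q0 - Q ** R1) ** R0) + norm (Q ** E3))"
    unfolding split by (meson add_left_mono norm_triangle_ineq norm_triangle_ineq4 order_trans)
  also have "\<dots> \<le> ?gm * m * (1.1 / a) * r + (?gm * m * (1.102 / a) * q * r + ?gm * m * (1.102 / a) * q * r)"
    using t1 t2 t3 by (intro add_mono)
  also have "\<dots> = ?gm * m * ((1.1 + 2.204 * q) / a * r)"
    by (simp add: add_divide_distrib algebra_simps)
  also have "\<dots> \<le> (501 / 500 * (m * u)) * m * ((1.1 + 2.204 * q) / a * r)"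
    using gm(2) dims q0 ab r0 by (intro mult_right_mono) auto
  also have "\<dots> = (501 / 500 * (1.1 + 2.204 * q)) / a * r * y"
    by (simp add: y_def power2_eq_square)
  also have "\<dots> \<le> (56 / h + 1.5 * sqrt (1 + B)) / a * r * y"
    using coeff q0 ab r0 y0 by (intro mult_right_mono divide_right_mono) auto
  finally show "spectral_norm (V - Q ** R) \<le> (56 / (25 * (a / b) - 3) + 1.5 * sqrt (1 + B)) / a
      * (b * spectral_norm V + a / 12 * \<sigma> * \<delta>) * m\<^sup>2 * u"
    by (simp add: h_def r_def y_def mult.assoc)
qed

section \<open>The embedding event\<close>

lemma subspace_embedding_range_iff:
  fixes S :: "real^'n^'p" and V :: "real^'m^'n"
  shows "subspace_embedding \<epsilon> S (range ((*v) V)) \<longleftrightarrow>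
    (\<forall>x y. \<bar>(V *v x) \<bullet> (V *v y) - (S *v (V *v x)) \<bullet> (S *v (V *v y))\<bar>
            \<le> \<epsilon> * norm (V *v x) * norm (V *v y))"
  by (auto simp: subspace_embedding_def)

lemma continuous_on_matrix_vector [continuous_intros]:
  fixes f :: "'a::topological_space \<Rightarrow> real^'c^'r"
  assumes "continuous_on T f" "continuous_on T g"
  shows "continuous_on T (\<lambda>x. f x *v g x)"
proof -
  have "continuous_on T (\<lambda>x. \<chi> i. \<Sum>j\<in>UNIV. f x $ i $ j * g x $ j)"
    by (intro continuous_on_vec_lambda continuous_intros assms)
  then show ?thesis by (simp add: matrix_vector_mult_def)
qed

lemma continuous_on_matrix_mult [continuous_intros]:
  fixes f :: "'a::topological_space \<Rightarrow> real^'k^'r" and g :: "'a \<Rightarrow> real^'c^'k"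
  assumes "continuous_on T f" "continuous_on T g"
  shows "continuous_on T (\<lambda>x. f x ** g x)"
proof -
  have "continuous_on T (\<lambda>x. \<chi> i j. \<Sum>k\<in>UNIV. f x $ i $ k * g x $ k $ j)"
    by (intro continuous_on_vec_lambda continuous_intros assms)
  then show ?thesis by (simp add: matrix_matrix_mult_def)
qed

text \<open>For fixed coordinate vectors both sides of the embedding inequality are continuous in
  \<open>z\<close>, so the set is an intersection of closed sets and thus Borel. The basis may vary
  with \<open>z\<close> because the subspace sketched by \<open>S2\<close> depends on
  \<open>S1\<close>.\<close>

lemma closed_subspace_embedding:
  fixes f :: "'a::topological_space \<Rightarrow> real^'n^'p" and g :: "'a \<Rightarrow> real^'m^'n"
  assumes "continuous_on UNIV f" "continuous_on UNIV g"
  shows "closed {z. subspace_embedding \<epsilon> (f z) (range ((*v) (g z)))}"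
  unfolding subspace_embedding_range_iff
  by (intro closed_Collect_all closed_Collect_le continuous_intros assms)

text \<open>With \<open>\<epsilon> < 1\<close> no nonzero vector of the range can be annihilated.
  The sketched range therefore keeps dimension exactly \<open>m\<close>, the dimension for which
  \<open>S2\<close> is oblivious.\<close>

lemma inj_sketched_basis:
  fixes S :: "real^'n^'p" and V :: "real^'m^'n"
  assumes "subspace_embedding \<epsilon> S (range ((*v) V))" "\<epsilon> < 1" "inj ((*v) V)"
  shows "inj ((*v) (S ** V))"
proof -
  have "x = 0" if "(S ** V) *v x = 0" for x
  proof -
    have "S *v (V *v x) = 0" using that by (simp add: matrix_vector_mul_assoc)
    then have "norm (V *v x) * norm (V *v x) \<le> \<epsilon> * (norm (V *v x) * norm (V *v x))"
      using assms(1) [unfolded subspace_embedding_range_iff, rule_format, of x x]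
      by (simp add: mult.assoc flip: power2_norm_eq_inner power2_eq_square)
    then have "(1 - \<epsilon>) * (norm (V *v x) * norm (V *v x)) \<le> 0" by (simp add: algebra_simps)
    then have "V *v x = 0" using assms(2) by (simp add: mult_le_0_iff)
    then show "x = 0" using assms(3) by (metis injD matrix_vector_mult_0_right)
  qed
  then show ?thesis
    by (metis matrix_left_invertible_injective matrix_left_invertible_ker)
qed

lemma dim_range_inj:
  fixes V :: "real^'m^'n"
  assumes "inj ((*v) V)"
  shows "subspace (range ((*v) V)) \<and> dim (range ((*v) V)) = CARD('m)"
proof
  show "subspace (range ((*v) V))"
    by (intro linear_subspace_image) simp_all
  show "dim (range ((*v) V)) = CARD('m)"
    using assms by (metis full_rank_injective rank_dim_range)
qed

text \<open>On rectangles independence is the product rule, and rectangles determine the product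
  measure.\<close>

lemma (in prob_space) indep_distr_pair:
  fixes X :: "'a \<Rightarrow> 'b::second_countable_topology" and Y :: "'a \<Rightarrow> 'c::second_countable_topology"
  assumes X [measurable]: "X \<in> borel_measurable M" and Y [measurable]: "Y \<in> borel_measurable M"
    and "indep_set (sets (vimage_algebra (space M) X borel)) (sets (vimage_algebra (space M) Y borel))"
  shows "distr M borel X \<Otimes>\<^sub>M distr M borel Y = distr M borel (\<lambda>\<omega>. (X \<omega>, Y \<omega>))"
proof (rule pair_measure_eqI)
  interpret PX: prob_space "distr M borel X" by (rule prob_space_distr) fact
  interpret PY: prob_space "distr M borel Y" by (rule prob_space_distr) fact
  show "sigma_finite_measure (distr M borel X)" "sigma_finite_measure (distr M borel Y)" ..
  show "sets (distr M borel X \<Otimes>\<^sub>M distr M borel Y) = sets (distr M borel (\<lambda>\<omega>. (X \<omega>, Y \<omega>)))"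
    by (simp add: borel_prod [symmetric] cong: sets_pair_measure_cong)
  fix A B
  assume "A \<in> sets (distr M borel X)" "B \<in> sets (distr M borel Y)"
  then have [measurable]: "A \<in> sets borel" "B \<in> sets borel" by simp_all
  have "prob ((X -` A \<inter> space M) \<inter> (Y -` B \<inter> space M))
      = prob (X -` A \<inter> space M) * prob (Y -` B \<inter> space M)"
    using assms(3) by (rule indep_setD) (simp_all add: in_vimage_algebra)
  moreover have "(X -` A \<inter> space M) \<inter> (Y -` B \<inter> space M)
      = (\<lambda>\<omega>. (X \<omega>, Y \<omega>)) -` (A \<times> B) \<inter> space M" by auto
  ultimately have "emeasure M ((\<lambda>\<omega>. (X \<omega>, Y \<omega>)) -` (A \<times> B) \<inter> space M)
      = emeasure M (X -` A \<inter> space M) * emeasure M (Y -` B \<inter> space M)"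
    by (simp add: emeasure_eq_measure ennreal_mult)
  moreover have "A \<times> B \<in> sets borel"
    by (simp add: borel_prod [symmetric])
  moreover have "(\<lambda>\<omega>. (X \<omega>, Y \<omega>)) \<in> borel_measurable M"
    by (simp add: borel_prod [symmetric])
  ultimately show "emeasure (distr M borel X) A * emeasure (distr M borel Y) B
      = emeasure (distr M borel (\<lambda>\<omega>. (X \<omega>, Y \<omega>))) (A \<times> B)"
    by (simp add: emeasure_distr)
qed

text \<open>Fubini: the probability of \<open>E\<close> is the integral of its slice probabilities
  over the law of \<open>X\<close>, and these are at least \<open>q\<close> on \<open>A\<close>, a
  set of mass at least \<open>p\<close>.\<close>

lemma (in prob_space) prob_indep_ge_mult:
  fixes X :: "'a \<Rightarrow> 'b::second_countable_topology" and Y :: "'a \<Rightarrow> 'c::second_countable_topology"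
  assumes X [measurable]: "X \<in> borel_measurable M" and Y [measurable]: "Y \<in> borel_measurable M"
    and indep: "indep_set (sets (vimage_algebra (space M) X borel))
                          (sets (vimage_algebra (space M) Y borel))"
    and A: "A \<in> sets borel" and E: "E \<in> sets borel"
    and p: "prob {\<omega> \<in> space M. X \<omega> \<in> A} \<ge> p"
    and q: "\<And>x. x \<in> A \<Longrightarrow> prob {\<omega> \<in> space M. (x, Y \<omega>) \<in> E} \<ge> q" and pq: "0 \<le> p" "0 \<le> q"
  shows "prob {\<omega> \<in> space M. (X \<omega>, Y \<omega>) \<in> E} \<ge> p * q"
proof -
  interpret PX: prob_space "distr M borel X" by (rule prob_space_distr) fact
  interpret PY: prob_space "distr M borel Y" by (rule prob_space_distr) fact
  have E': "E \<in> sets (distr M borel X \<Otimes>\<^sub>M distr M borel Y)"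
    using E by (simp add: borel_prod [symmetric] cong: sets_pair_measure_cong)
  have XY: "(\<lambda>\<omega>. (X \<omega>, Y \<omega>)) \<in> borel_measurable M"
    by (simp add: borel_prod [symmetric])
  have slice: "{y. (x, y) \<in> E} \<in> sets borel" for x
    using sets_Pair1 [OF E', of x] by (simp add: vimage_def)
  have "ennreal p * ennreal q \<le> emeasure (distr M borel X) A * ennreal q"
    using p A by (intro mult_right_mono)
      (simp_all add: emeasure_distr emeasure_eq_measure vimage_def Int_def conj_commute)
  also have "\<dots> = (\<integral>\<^sup>+x. ennreal q * indicator A x \<partial>distr M borel X)"
    using A by (simp add: nn_integral_cmult_indicator mult.commute)
  also have "\<dots> \<le> (\<integral>\<^sup>+x. emeasure (distr M borel Y) (Pair x -` E) \<partial>distr M borel X)"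
  proof (rule nn_integral_mono)
    fix x
    show "ennreal q * indicator A x \<le> emeasure (distr M borel Y) (Pair x -` E)"
      using q [of x] slice [of x]
      by (auto simp: indicator_def emeasure_distr emeasure_eq_measure vimage_def Int_def conj_commute
          intro!: ennreal_leI)
  qed
  also have "\<dots> = emeasure (distr M borel X \<Otimes>\<^sub>M distr M borel Y) E"
    by (rule PY.emeasure_pair_measure_alt [symmetric]) (rule E')
  also have "\<dots> = emeasure M {\<omega> \<in> space M. (X \<omega>, Y \<omega>) \<in> E}"
    unfolding indep_distr_pair [OF X Y indep]
    using E XY by (simp add: emeasure_distr vimage_def Int_def conj_commute)
  finally show ?thesis
    using pq by (simp add: emeasure_eq_measure flip: ennreal_mult)
qed

text \<open>Obliviousness of \<open>S2\<close> speaks of fixed subspaces, whereas the range of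
  \<open>S1 \<omega> ** V\<close> is random. Independence allows \<open>S1\<close> to be frozen at a
  value \<open>S\<close>; slicing then applies the property of \<open>S2\<close> to the fixed range
  of \<open>S ** V\<close>.\<close>

lemma sequential_embedding_event:
  fixes M :: "'w measure" and S1 :: "'w \<Rightarrow> real^'n^'p1" and S2 :: "'w \<Rightarrow> real^'p1^'p2"
    and V :: "real^'m^'n"
  assumes M: "prob_space M"
    and e1: "oblivious_subspace_embedding M S1 \<epsilon>1 d1 CARD('m)" and "\<epsilon>1 < 1" "d1 \<le> 1"
    and e2: "oblivious_subspace_embedding M S2 \<epsilon>2 d2 CARD('m)" and "d2 \<le> 1"
    and indep: "prob_space.indep_set M (sets (vimage_algebra (space M) S1 borel))
                                       (sets (vimage_algebra (space M) S2 borel))"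
    and V: "rank V = CARD('m)"
  shows "{\<omega> \<in> space M. subspace_embedding \<epsilon>1 (S1 \<omega>) (range ((*v) V)) \<and>
             subspace_embedding \<epsilon>2 (S2 \<omega>) (range ((*v) (S1 \<omega> ** V)))} \<in> sets M" (is "?G \<in> _")
    and "measure M {\<omega> \<in> space M. subspace_embedding \<epsilon>1 (S1 \<omega>) (range ((*v) V)) \<and>
             subspace_embedding \<epsilon>2 (S2 \<omega>) (range ((*v) (S1 \<omega> ** V)))} \<ge> (1 - d1) * (1 - d2)"
proof -
  interpret prob_space M by fact
  have S1: "S1 \<in> borel_measurable M" and S2: "S2 \<in> borel_measurable M"
    using e1 e2 by (simp_all add: oblivious_subspace_embedding_def)
  have inj: "inj ((*v) V)" using V by (simp add: full_rank_injective)
  define A where "A = {S :: real^'n^'p1. subspace_embedding \<epsilon>1 S (range ((*v) V))}"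
  define E where "E = {z :: (real^'n^'p1) \<times> (real^'p1^'p2).
    subspace_embedding \<epsilon>1 (fst z) (range ((*v) V)) \<and>
    subspace_embedding \<epsilon>2 (snd z) (range ((*v) (fst z ** V)))}"
  have A: "A \<in> sets borel"
    unfolding A_def by (intro borel_closed closed_subspace_embedding continuous_intros)
  have E: "E \<in> sets borel"
    unfolding E_def
    by (intro borel_closed closed_Collect_conj closed_subspace_embedding continuous_intros)
  have G: "?G = {\<omega> \<in> space M. (S1 \<omega>, S2 \<omega>) \<in> E}"
    by (simp add: E_def)
  have "(\<lambda>\<omega>. (S1 \<omega>, S2 \<omega>)) \<in> borel_measurable M"
    using S1 S2 by (simp add: borel_prod [symmetric])
  from measurable_sets [OF this E] show "?G \<in> sets M"
    unfolding G by (simp add: vimage_def Int_def conj_commute)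
  have "(1 - d1) * (1 - d2) \<le> prob {\<omega> \<in> space M. (S1 \<omega>, S2 \<omega>) \<in> E}"
  proof (rule prob_indep_ge_mult [OF S1 S2 indep A E])
    show "1 - d1 \<le> prob {\<omega> \<in> space M. S1 \<omega> \<in> A}"
      using e1 dim_range_inj [OF inj] by (simp add: oblivious_subspace_embedding_def A_def)
    show "1 - d2 \<le> prob {\<omega> \<in> space M. (S, S2 \<omega>) \<in> E}" if "S \<in> A" for S
    proof -
      have S: "subspace_embedding \<epsilon>1 S (range ((*v) V))" using that by (simp add: A_def)
      have "inj ((*v) (S ** V))" by (rule inj_sketched_basis) fact+
      from dim_range_inj [OF this] show ?thesis
        using e2 S by (simp add: oblivious_subspace_embedding_def E_def)
    qed
  qed (use assms in simp_all)
  then show "(1 - d1) * (1 - d2) \<le> prob ?G" by (simp only: G)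
qed

lemma subspace_embedding_norm_bounds:
  assumes "subspace_embedding \<epsilon> S T" "v \<in> T"
  shows "sqrt (1 - \<epsilon>) * norm v \<le> norm (S *v v)" "norm (S *v v) \<le> sqrt (1 + \<epsilon>) * norm v"
proof -
  have "\<bar>(norm v)\<^sup>2 - (norm (S *v v))\<^sup>2\<bar> \<le> \<epsilon> * (norm v)\<^sup>2"
    using assms unfolding subspace_embedding_def
    by (metis power2_norm_eq_inner power2_eq_square mult.assoc)
  then have "(1 - \<epsilon>) * (norm v)\<^sup>2 \<le> (norm (S *v v))\<^sup>2" "(norm (S *v v))\<^sup>2 \<le> (1 + \<epsilon>) * (norm v)\<^sup>2"
    by (simp_all add: algebra_simps)
  then have "sqrt ((1 - \<epsilon>) * (norm v)\<^sup>2) \<le> norm (S *v v)" "norm (S *v v) \<le> sqrt ((1 + \<epsilon>) * (norm v)\<^sup>2)"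
    by (simp_all add: real_le_lsqrt real_le_rsqrt real_sqrt_le_iff' real_sqrt_le_mono)
  then show "sqrt (1 - \<epsilon>) * norm v \<le> norm (S *v v)" "norm (S *v v) \<le> sqrt (1 + \<epsilon>) * norm v"
    by (simp_all add: real_sqrt_mult)
qed

theorem theorem5p3:
  fixes M :: "'w measure"
    and S1 :: "'w \<Rightarrow> real^'n^'p1"
    and S2 :: "'w \<Rightarrow> real^'p1^'p2"
    and V :: "real^('m::{finite,linorder})^'n"
    and \<epsilon>1 \<epsilon>2 d1 d2 d \<epsilon>L \<epsilon>H u n m p1 p2 :: real
    and \<delta> :: "'w \<Rightarrow> real"
  assumes "prob_space M"
    and "0 \<le> \<epsilon>1" "\<epsilon>1 < 1" "0 \<le> \<epsilon>2" "\<epsilon>2 < 1"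
    and "0 \<le> d1" "d1 \<le> 1" "0 \<le> d2" "d2 \<le> 1"
    and "oblivious_subspace_embedding M S1 \<epsilon>1 d1 CARD('m)"
    and "oblivious_subspace_embedding M S2 \<epsilon>2 d2 CARD('m)"
    and "prob_space.indep_set M (sets (vimage_algebra (space M) S1 borel))
                               (sets (vimage_algebra (space M) S2 borel))"
    and "d = d1 + d2 - d1 * d2"
    and "\<epsilon>L = \<epsilon>1 + \<epsilon>2 - \<epsilon>1 * \<epsilon>2"
    and "\<epsilon>H = \<epsilon>1 + \<epsilon>2 + \<epsilon>1 * \<epsilon>2"
    and "0 \<le> \<epsilon>L" "\<epsilon>L < 616/625 - 9/625 * \<epsilon>H"
    and "rank V = CARD('m)"
    and "1 < CARD('m)" "CARD('m) \<le> CARD('p2)" "CARD('p2) \<le> CARD('p1)" "CARD('p1) \<le> CARD('n)"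
    and "n = real CARD('n)" "m = real CARD('m)" "p1 = real CARD('p1)" "p2 = real CARD('p2)"
    and "0 < u"
    and "n * m * u \<le> 1/12"
    and "p1 * sqrt p2 * u \<le> 1/12"
    and "\<And>\<omega>. \<delta> \<omega> =
      383 * (sqrt (1 + \<epsilon>H) * p2 * m powr (3/2)
             + sqrt m * spectral_norm (S2 \<omega>)
               * (p1 * sqrt p2 * sqrt (1 + \<epsilon>1) + n * frobenius_norm (S1 \<omega>)))
        / sqrt (1 - \<epsilon>L) * u * cond_number V"
  \<comment> \<open>\<open>\<delta>\<close> depends on the drawn matrices, so the assumption \<open>\<delta> \<le> 1\<close> is imposed draw by draw; the
      result implies the version in which \<open>\<delta> \<le> 1\<close> is assumed for all draws.\<close>
  shows "\<exists>A\<in>sets M. measure M A \<ge> 1 - d \<and>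
    (\<forall>\<omega>\<in>A. \<delta> \<omega> \<le> 1 \<longrightarrow> (\<forall>Q R. fl_rand_cholQR u V (S1 \<omega>) (S2 \<omega>) Q R \<longrightarrow>
       spectral_norm (transpose Q ** Q - mat 1)
         \<le> 5445 / (25 * sqrt ((1 - \<epsilon>L) / (1 + \<epsilon>H)) - 3)\<^sup>2 * (n * m + m * (m + 1)) * u
       \<and>
       spectral_norm (V - Q ** R)
         \<le> (56 / (25 * ((1 - \<epsilon>L) / sqrt (1 + \<epsilon>H)) - 3 * sqrt (1 - \<epsilon>L))
             + 1.5 / sqrt (1 - \<epsilon>L)
               * sqrt (1 + 5445 * (n * m + m * (m + 1)) * u
                             / (25 * sqrt ((1 - \<epsilon>L) / (1 + \<epsilon>H)) - 3)\<^sup>2))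
           * (sqrt (1 + \<epsilon>H) * spectral_norm V + sqrt (1 - \<epsilon>L) / 12 * sigma_min V * \<delta> \<omega>)
           * m\<^sup>2 * u
           + \<delta> \<omega> / 10 * sigma_min V))"
proof -
  define a b c where "a = sqrt (1 - \<epsilon>L)" and "b = sqrt (1 + \<epsilon>H)" and "c = sqrt (1 + \<epsilon>1)"
  define G where "G = {\<omega> \<in> space M. subspace_embedding \<epsilon>1 (S1 \<omega>) (range ((*v) V)) \<and>
    subspace_embedding \<epsilon>2 (S2 \<omega>) (range ((*v) (S1 \<omega> ** V)))}"
  have eH: "0 \<le> \<epsilon>H" using \<open>\<epsilon>H = _\<close> \<open>0 \<le> \<epsilon>1\<close> \<open>0 \<le> \<epsilon>2\<close> by simp
  have eL: "0 \<le> \<epsilon>L" "625 * \<epsilon>L + 9 * \<epsilon>H < 616"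
    using \<open>0 \<le> \<epsilon>L\<close> \<open>\<epsilon>L < 616/625 - 9/625 * \<epsilon>H\<close> by simp_all
  have ab: "0 < a" "a \<le> b" "3 * b < 25 * a" "0 < b"
  proof -
    show "0 < a" "a \<le> b" "0 < b" using eH eL by (simp_all add: a_def b_def)
    \<comment> \<open>This is the assumed upper bound on \<open>\<epsilon>L\<close>, rewritten as
      \<open>9 * (1 + \<epsilon>H) < 625 * (1 - \<epsilon>L)\<close>.\<close>
    have "(3 * b)\<^sup>2 < (25 * a)\<^sup>2" using eH eL by (simp add: a_def b_def power_mult_distrib)
    then show "3 * b < 25 * a" by (rule power_less_imp_less_base) (use \<open>0 < a\<close> in simp)
  qed
  \<comment> \<open>\<open>1 - \<epsilon>L\<close> and \<open>1 + \<epsilon>H\<close> factor into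
    the distortions of the two sketches.\<close>
  have ab_prod: "a = sqrt (1 - \<epsilon>2) * sqrt (1 - \<epsilon>1)" "b = sqrt (1 + \<epsilon>2) * sqrt (1 + \<epsilon>1)"
    unfolding a_def b_def \<open>\<epsilon>L = _\<close> \<open>\<epsilon>H = _\<close> real_sqrt_mult [symmetric] by (simp_all add: algebra_simps)
  have \<sigma>: "0 < sigma_min V" using \<open>rank V = CARD('m)\<close> by (rule sigma_min_pos)
  have dims: "2 \<le> m" "m \<le> p2" "m \<le> n"
    using assms(19-26) by simp_all
  have "m powr (3/2) = m powr 1 * m powr (1/2)" unfolding powr_add [symmetric] by simp
  also have "\<dots> = m * sqrt m" using dims by (simp add: powr_half_sqrt)
  finally have m_powr: "m powr (3/2) = m * sqrt m" .
  define h where "h = 25 * (a / b) - 3"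
  have h: "25 * sqrt ((1 - \<epsilon>L) / (1 + \<epsilon>H)) - 3 = h"
    by (simp add: h_def a_def b_def real_sqrt_divide)
  have h0: "0 < h" using ab by (simp add: h_def field_simps)
  have "(1 - \<epsilon>L) = a * a" using eL eH by (simp add: a_def)
  then have ha: "25 * ((1 - \<epsilon>L) / sqrt (1 + \<epsilon>H)) - 3 * sqrt (1 - \<epsilon>L) = h * a"
    by (simp add: h_def algebra_simps flip: a_def b_def)
  note event = sequential_embedding_event [OF \<open>prob_space M\<close> \<open>oblivious_subspace_embedding M S1 \<epsilon>1 d1 CARD('m)\<close>
      \<open>\<epsilon>1 < 1\<close> \<open>d1 \<le> 1\<close> \<open>oblivious_subspace_embedding M S2 \<epsilon>2 d2 CARD('m)\<close> \<open>d2 \<le> 1\<close> assms(12)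
      \<open>rank V = CARD('m)\<close>, folded G_def]
  show ?thesis
  proof (intro bexI [of _ G] conjI ballI impI allI)
    show "G \<in> sets M" by (rule event)
    show "1 - d \<le> measure M G" using event(2) by (simp add: \<open>d = _\<close> algebra_simps)
    fix \<omega> Q R
    assume "\<omega> \<in> G" and \<delta>1: "\<delta> \<omega> \<le> 1" and fl: "fl_rand_cholQR u V (S1 \<omega>) (S2 \<omega>) Q R"
    then have e1: "subspace_embedding \<epsilon>1 (S1 \<omega>) (range ((*v) V))"
      and e2: "subspace_embedding \<epsilon>2 (S2 \<omega>) (range ((*v) (S1 \<omega> ** V)))"
      by (simp_all add: G_def)
    note n1 = subspace_embedding_norm_bounds [OF e1 rangeI]
    note n2 = subspace_embedding_norm_bounds [OF e2 rangeI, folded matrix_vector_mul_assoc]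
    have lower: "a * norm (V *v x) \<le> norm (S2 \<omega> *v (S1 \<omega> *v (V *v x)))" for x
    proof -
      have "sqrt (1 - \<epsilon>2) * (sqrt (1 - \<epsilon>1) * norm (V *v x)) \<le> sqrt (1 - \<epsilon>2) * norm (S1 \<omega> *v (V *v x))"
        by (intro mult_left_mono n1) (use \<open>\<epsilon>2 < 1\<close> in simp)
      also note n2(1)
      finally show ?thesis by (simp add: ab_prod mult.assoc)
    qed
    have upper: "norm (S2 \<omega> *v (S1 \<omega> *v (V *v x))) \<le> b * norm (V *v x)" for x
    proof -
      note n2(2)
      also have "sqrt (1 + \<epsilon>2) * norm (S1 \<omega> *v (V *v x)) \<le> sqrt (1 + \<epsilon>2) * (sqrt (1 + \<epsilon>1) * norm (V *v x))"
        by (intro mult_left_mono n1) (use \<open>0 \<le> \<epsilon>2\<close> in simp)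
      finally show ?thesis by (simp add: ab_prod mult.assoc)
    qed
    \<comment> \<open>Multiplying by \<open>a * sigma_min V\<close> clears both denominators, that
      of \<open>\<delta>\<close> and that of \<open>cond_number V\<close>.\<close>
    have \<delta>: "383 * ((b * p2 * (m * sqrt m)
        + sqrt m * spectral_norm (S2 \<omega>) * (p1 * sqrt p2 * c + n * norm (S1 \<omega>))) * u * sigma_max V)
        = a * sigma_min V * \<delta> \<omega>"
      using ab \<sigma> unfolding assms(30) m_powr cond_number_def
      by (simp flip: a_def b_def c_def)
    define B where "B = 5445 / (25 * (a / b) - 3)\<^sup>2 * (n * m + m * (m + 1)) * u"
    note bounds = rand_cholQR_bounds [OF fl n1(2) [folded c_def] lower upper sigma_min_le
        spectral_norm_le_sigma_max ab(1-3) _ \<sigma> \<open>0 < u\<close> assms(23-26) dims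
        \<open>p1 * sqrt p2 * u \<le> 1/12\<close> \<delta> \<delta>1 B_def]
    have c0: "0 \<le> c" using \<open>0 \<le> \<epsilon>1\<close> by (simp add: c_def)
    show "spectral_norm (transpose Q ** Q - mat 1)
         \<le> 5445 / (25 * sqrt ((1 - \<epsilon>L) / (1 + \<epsilon>H)) - 3)\<^sup>2 * (n * m + m * (m + 1)) * u"
      using bounds(1) [OF c0] unfolding B_def h h_def [symmetric] .
    have B_h: "5445 * (n * m + m * (m + 1)) * u / h\<^sup>2 = B" by (simp add: B_def h_def)
    have "(56 / h + 1.5 * sqrt (1 + B)) / a = 56 / (h * a) + 1.5 / a * sqrt (1 + B)"
      by (simp add: add_divide_distrib)
    \<comment> \<open>Nonnegativity lets the last summand be added to the bound from
      \<open>rand_cholQR_bounds\<close>.\<close>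
    moreover have "0 \<le> \<delta> \<omega> / 10 * sigma_min V"
    proof -
      have "0 \<le> sigma_max V"
        using spectral_norm_nonneg spectral_norm_le_sigma_max order_trans by blast
      moreover have "0 \<le> p1" using assms(25) by simp
      ultimately have "0 \<le> a * sigma_min V * \<delta> \<omega>"
        unfolding \<delta> [symmetric] using ab c0 dims \<open>0 < u\<close> by (simp add: spectral_norm_nonneg)
      then have "0 \<le> \<delta> \<omega>" using mult_pos_pos [OF ab(1) \<sigma>] by (smt (verit) mult_pos_neg)
      then show ?thesis using \<sigma> by simp
    qed
    ultimately show "spectral_norm (V - Q ** R)
         \<le> (56 / (25 * ((1 - \<epsilon>L) / sqrt (1 + \<epsilon>H)) - 3 * sqrt (1 - \<epsilon>L))
             + 1.5 / sqrt (1 - \<epsilon>L)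
               * sqrt (1 + 5445 * (n * m + m * (m + 1)) * u
                             / (25 * sqrt ((1 - \<epsilon>L) / (1 + \<epsilon>H)) - 3)\<^sup>2))
           * (sqrt (1 + \<epsilon>H) * spectral_norm V + sqrt (1 - \<epsilon>L) / 12 * sigma_min V * \<delta> \<omega>)
           * m\<^sup>2 * u
           + \<delta> \<omega> / 10 * sigma_min V"
      using bounds(2) [OF c0] unfolding h ha B_h
      unfolding a_def [symmetric] b_def [symmetric] h_def [symmetric] by simp
  qed
qed

end
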